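(* Let $(\sigma,\pi)$ be a compatible pair and let $(s_n)_{n\in\omega}$, $s_n\in\mathcal S(n+1)$, be the sequence derived from $(\sigma,\pi)$. Then $(s_n)_n$ is realised in the class of uniform chains of rank $\omega$; that is, there are a uniform chain $A$ of rank $\omega$ and an element $x\in A$ such that $[x]_n\cong\mathcal A(s_n)$ for all $n\in\omega$.
   Context: A chain is a linearly ordered set; $\cong$ is order isomorphism. $A+B$ is the ordered sum, $AB=\sum_{b\in B}A$ the anti-lexicographic product; $1$ is the one-element chain. For a chain $A$ define equivalence relations $\rho_\alpha$: $\rho_0$ is equality; $A/\alpha$ is the quotient chain of classes $[x]_\alpha$ (the $\alpha$-components); $x\rho_{\alpha+1}y$ iff the interval between $[x]_\alpha$ and $[y]_\alpha$ in $A/\alpha$ is finite; for limit $\alpha$, $x\rho_\alpha y$ iff $x\rho_\beta y$ for some $\beta<\alpha$. $\mathrm{rk}(A)$ is the least $\alpha$ with $A/\alpha\cong1$. $A$ is uniform if $A^{\ge x}=\{y\in A:x\le y\}$ has the same order type for all $x\in A$. $\mathcal S(\alpha)$ is the set of sequences $s:\alpha\to\alpha$ with $s(i)\le i$ for all $i<\alpha$; $s\restriction k$ is restriction and $t^\frown a$ is $t$ with the entry $a$ appended. For $s\in\mathcal S(n+1)$, $n\ge1$: $s^-=s\restriction n$, and $s^+$ is $s$ with the next-to-last entry $s(n-1)$ deleted (in $\mathcal S(n)$ iff $s(n)<n$). Put $\mathcal A(\langle0\rangle)=1$, $\mathcal A(s)=\mathcal A(s^-)\mathbb Z$ if $s(n)=n$,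 and $\mathcal A(s)=\mathcal A(s^+)+\mathcal A(s^-)\mathbb N$ if $s(n)<n$. By Pastijn's theorem the chains $\mathcal A(s)$, $s\in\mathcal S(n+1)$, exhaust the uniform chains of rank $n$ up to isomorphism. Let $\sigma\in\mathcal S(\omega+1)$ and $\pi:\omega\to\omega+1$. For $n\in\omega$ let $w_n$ be the least $v$ with $n\le v<\omega$ and $\pi(v)>0$ if such $v$ exists, and $w_n=\omega$ otherwise. The pair $(\sigma,\pi)$ is compatible if (i) for all $k\in\omega$, $\sigma(k)=k$ iff $\pi(k)=\omega$; and (ii) for every $n\in\omega$ with $\pi(n)=0$, $\sigma(w_n)\le n$. The sequence derived from $(\sigma,\pi)$ is given by $s_n=\sigma\restriction(n+1)$ if $\pi(n)>0$, and $s_n=(\sigma\restriction n)^\frown\sigma(w_n)$ if $\pi(n)=0$. *)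

theory Defs
  imports "HOL-Library.Extended_Nat" "HOL-Library.Nat_Bijection"
begin

abbreviation chain :: "'a rel \<Rightarrow> bool" where
  "chain r \<equiv> Linear_order r"

definition chain_iso :: "'a rel \<Rightarrow> 'b rel \<Rightarrow> bool" (infix "\<cong>\<^sub>c" 50) where
  "r \<cong>\<^sub>c s \<longleftrightarrow> (\<exists>f. bij_betw f (Field r) (Field s) \<and>
     (\<forall>x\<in>Field r. \<forall>y\<in>Field r. (x, y) \<in> r \<longleftrightarrow> (f x, f y) \<in> s))"

definition one_chain :: "nat rel" where
  "one_chain = {(0, 0)}"

definition nat_chain :: "nat rel" where
  "nat_chain = {(m, n). m \<le> n}"

definition int_chain :: "int rel" where
  "int_chain = {(m, n). m \<le> n}"

definition chain_sum :: "'a rel \<Rightarrow> 'b rel \<Rightarrow> ('a + 'b) rel" where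
  "chain_sum r s =
     {(Inl x, Inl y) | x y. (x, y) \<in> r} \<union>
     {(Inl x, Inr y) | x y. x \<in> Field r \<and> y \<in> Field s} \<union>
     {(Inr x, Inr y) | x y. (x, y) \<in> s}"

text \<open>The product is anti-lexicographic: the second coordinate is compared first.\<close>

definition chain_prod :: "'a rel \<Rightarrow> 'b rel \<Rightarrow> ('a \<times> 'b) rel" where
  "chain_prod r s =
     {((a, b), (a', b')) | a b a' b'.
        a \<in> Field r \<and> a' \<in> Field r \<and> (b, b') \<in> s \<and> (b = b' \<longrightarrow> (a, a') \<in> r)}"

definition uniform_chain :: "'a rel \<Rightarrow> bool" where
  "uniform_chain r \<longleftrightarrow> chain r \<and>
     (\<forall>x\<in>Field r. \<forall>y\<in>Field r. Restr r (above r x) \<cong>\<^sub>c Restr r (above r y))"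

text \<open>
  The quotient chain by an equivalence relation with convex classes: two classes are
  comparable as soon as they have comparable representatives.
\<close>

definition quotient_chain :: "'a rel \<Rightarrow> 'a rel \<Rightarrow> 'a set rel" where
  "quotient_chain r e =
     {(X, Y). X \<in> Field r // e \<and> Y \<in> Field r // e \<and> (\<exists>x\<in>X. \<exists>y\<in>Y. (x, y) \<in> r)}"

definition between :: "'a rel \<Rightarrow> 'a \<Rightarrow> 'a \<Rightarrow> 'a set" where
  "between r x y = {z. ((x, z) \<in> r \<and> (z, y) \<in> r) \<or> ((y, z) \<in> r \<and> (z, x) \<in> r)}"

definition rho_step :: "'a rel \<Rightarrow> 'a rel \<Rightarrow> 'a rel" where
  "rho_step r e = {(x, y). x \<in> Field r \<and> y \<in> Field r \<and>
     finite (between (quotient_chain r e) (e `` {x}) (e `` {y}))}"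

definition is_successor :: "'o::wellorder \<Rightarrow> 'o \<Rightarrow> bool" where
  "is_successor \<beta> \<alpha> \<longleftrightarrow> \<beta> < \<alpha> \<and> (\<forall>\<gamma>. \<gamma> < \<alpha> \<longrightarrow> \<gamma> \<le> \<beta>)"

text \<open>
  The ordinals indexing the equivalence relations are the elements of a well-ordered type;
  below this is \<open>enat\<close>, whose elements are the ordinals up to and including \<open>\<omega> = \<infinity>\<close>.
  Immediate predecessors are unique, so the first union is over a singleton.
\<close>

function rho :: "'a rel \<Rightarrow> 'o::wellorder \<Rightarrow> 'a rel" where
  "rho r \<alpha> =
     (if \<forall>\<beta>. \<alpha> \<le> \<beta> then Id_on (Field r)
      else if \<exists>\<beta>. is_successor \<beta> \<alpha> then \<Union>\<beta>\<in>{\<beta>. is_successor \<beta> \<alpha>}. rho_step r (rho r \<beta>)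
      else \<Union>\<beta>\<in>{\<beta>. \<beta> < \<alpha>}. rho r \<beta>)"
  by auto
termination
  by (relation "inv_image {(x, y). x < y} snd")
    (auto simp: wf is_successor_def intro!: wf_inv_image)

declare rho.simps [simp del]

definition component :: "'a rel \<Rightarrow> 'o::wellorder \<Rightarrow> 'a \<Rightarrow> 'a rel" where
  "component r \<alpha> x = Restr r (rho r \<alpha> `` {x})"

definition has_rank :: "'a rel \<Rightarrow> 'o::wellorder \<Rightarrow> bool" where
  "has_rank r \<alpha> \<longleftrightarrow> quotient_chain r (rho r \<alpha>) \<cong>\<^sub>c one_chain \<and>
     (\<forall>\<beta><\<alpha>. \<not> quotient_chain r (rho r \<beta>) \<cong>\<^sub>c one_chain)"

lemma is_successor_unique: "is_successor \<beta> \<alpha> \<Longrightarrow> is_successor \<gamma> \<alpha> \<Longrightarrow> \<beta> = \<gamma>"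
  unfolding is_successor_def by (meson order_antisym)

lemma rho_least: "(\<And>\<beta>. \<alpha> \<le> \<beta>) \<Longrightarrow> rho r \<alpha> = Id_on (Field r)"
  by (subst rho.simps) simp

lemma rho_successor:
  assumes "is_successor \<beta> \<alpha>"
  shows "rho r \<alpha> = rho_step r (rho r \<beta>)"
proof -
  have eq: "{\<gamma>. is_successor \<gamma> \<alpha>} = {\<beta>}"
    using assms is_successor_unique by blast
  have "\<not> (\<forall>\<gamma>. \<alpha> \<le> \<gamma>)"
    using assms unfolding is_successor_def by (meson not_le)
  then show ?thesis
    using assms by (subst rho.simps) (auto simp: eq)
qed

lemma rho_enat_zero: "rho r (0::enat) = Id_on (Field r)"
  by (rule rho_least) simp

lemma rho_enat_Suc: "rho r (enat (Suc n)) = rho_step r (rho r (enat n))"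
proof (rule rho_successor)
  have "\<gamma> \<le> enat n" if "\<gamma> < enat (Suc n)" for \<gamma>
    using that by (cases \<gamma>) auto
  then show "is_successor (enat n) (enat (Suc n))"
    by (auto simp: is_successor_def)
qed

lemma rho_enat_infinity: "rho r (\<infinity>::enat) = (\<Union>n. rho r (enat n))"
proof -
  have no_succ: "\<not> is_successor \<beta> (\<infinity>::enat)" for \<beta> :: enat
  proof
    assume *: "is_successor \<beta> \<infinity>"
    then obtain n where "\<beta> = enat n"
      unfolding is_successor_def by (cases \<beta>) auto
    moreover have "enat (Suc n) \<le> \<beta>"
      using * unfolding is_successor_def by auto
    ultimately show False by simp
  qed
  have "\<not> (\<forall>\<beta>. (\<infinity>::enat) \<le> \<beta>)"
    by (auto intro: exI[of _ 0])
  moreover have "{\<beta>. \<beta> < (\<infinity>::enat)} = range enat"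
    by (auto dest: less_infinityE)
  ultimately show ?thesis
    by (subst rho.simps) (auto simp: no_succ)
qed

text \<open>
  A sequence of finite length is a list, and an \<open>\<omega>+1\<close>-sequence is a function on \<open>enat\<close>.
  The bound on the entries already forces the values to lie in the index set.
\<close>

definition S_fin :: "nat \<Rightarrow> enat list set" where
  "S_fin m = {s. length s = m \<and> (\<forall>i<m. s ! i \<le> enat i)}"

definition S_omega_plus_one :: "(enat \<Rightarrow> enat) set" where
  "S_omega_plus_one = {s. \<forall>i. s i \<le> i}"

definition seq_minus :: "'a list \<Rightarrow> 'a list" where
  "seq_minus s = butlast s"

definition seq_plus :: "'a list \<Rightarrow> 'a list" where
  "seq_plus s = butlast (butlast s) @ [last s]"

text \<open>
  All the chains are realised on natural numbers, by renaming the elements of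
  \<open>chain_prod\<close> and \<open>chain_sum\<close> along injections into \<open>nat\<close>.  A list \<open>s\<close> in \<open>S_fin (n + 1)\<close>
  has last entry \<open>s(n)\<close> with \<open>n = length s - 1\<close>.  Only lists in some \<open>S_fin (n + 1)\<close> matter.
\<close>

function chain_of :: "enat list \<Rightarrow> nat rel" where
  "chain_of s =
     (if length s \<le> 1 then one_chain
      else if last s = enat (length s - 1)
      then dir_image (chain_prod (chain_of (seq_minus s)) int_chain)
             (\<lambda>(a, z). prod_encode (a, int_encode z))
      else dir_image
             (chain_sum (chain_of (seq_plus s)) (chain_prod (chain_of (seq_minus s)) nat_chain))
             (\<lambda>p. sum_encode (map_sum id prod_encode p)))"
  by auto
termination
  by (relation "measure length") (auto simp: seq_minus_def seq_plus_def)

declare chain_of.simps [simp del]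

lemma dir_image_chain_iso:
  assumes "inj f"
  shows "dir_image r f \<cong>\<^sub>c r"
  unfolding chain_iso_def
proof (intro exI conjI)
  show "bij_betw (inv f) (Field (dir_image r f)) (Field r)"
    using assms by (auto simp: bij_betw_def dir_image_Field inj_on_def image_image)
  show "\<forall>x\<in>Field (dir_image r f). \<forall>y\<in>Field (dir_image r f).
      ((x, y) \<in> dir_image r f) = ((inv f x, inv f y) \<in> r)"
    using assms by (auto simp: dir_image_Field) (auto simp: dir_image_def dest: injD)
qed

lemma chain_of_singleton: "chain_of [a] = one_chain"
  by (simp add: chain_of.simps)

lemma chain_of_eq:
  assumes "length s = n + 1" "n \<ge> 1" "s ! n = enat n"
  shows "chain_of s \<cong>\<^sub>c chain_prod (chain_of (seq_minus s)) int_chain"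
proof -
  have "inj (\<lambda>(a::nat, z::int). prod_encode (a, int_encode z))"
    by (auto simp: inj_on_def prod_encode_eq int_encode_eq)
  moreover have "last s = enat n"
    using assms by (cases s rule: rev_cases) (auto simp: nth_append)
  ultimately show ?thesis
    using assms by (subst chain_of.simps) (simp add: dir_image_chain_iso)
qed

lemma chain_of_less:
  assumes "length s = n + 1" "n \<ge> 1" "s ! n < enat n"
  shows "chain_of s \<cong>\<^sub>c
    chain_sum (chain_of (seq_plus s)) (chain_prod (chain_of (seq_minus s)) nat_chain)"
proof -
  have "inj (\<lambda>p. sum_encode (map_sum id prod_encode (p :: nat + nat \<times> nat)))"
    by (rule injI)
      (auto simp: sum_encode_eq prod_encode_eq map_sum_def split: sum.splits)
  moreover have "last s < enat n"
    using assms by (cases s rule: rev_cases) (auto simp: nth_append)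
  ultimately show ?thesis
    using assms by (subst chain_of.simps) (auto simp add: dir_image_chain_iso)
qed

definition next_nonzero :: "(nat \<Rightarrow> enat) \<Rightarrow> nat \<Rightarrow> enat" where
  "next_nonzero \<pi> n =
     (if \<exists>v\<ge>n. \<pi> v > 0 then enat (LEAST v. n \<le> v \<and> \<pi> v > 0) else \<infinity>)"

definition compatible :: "(enat \<Rightarrow> enat) \<Rightarrow> (nat \<Rightarrow> enat) \<Rightarrow> bool" where
  "compatible \<sigma> \<pi> \<longleftrightarrow>
     (\<forall>k. \<sigma> (enat k) = enat k \<longleftrightarrow> \<pi> k = \<infinity>) \<and>
     (\<forall>n. \<pi> n = 0 \<longrightarrow> \<sigma> (next_nonzero \<pi> n) \<le> enat n)"

definition derived :: "(enat \<Rightarrow> enat) \<Rightarrow> (nat \<Rightarrow> enat) \<Rightarrow> nat \<Rightarrow> enat list" where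
  "derived \<sigma> \<pi> n =
     (if \<pi> n > 0 then map (\<lambda>i. \<sigma> (enat i)) [0..<n + 1]
      else map (\<lambda>i. \<sigma> (enat i)) [0..<n] @ [\<sigma> (next_nonzero \<pi> n)])"

lemma derived_in_S_fin:
  assumes "\<sigma> \<in> S_omega_plus_one" "compatible \<sigma> \<pi>"
  shows "derived \<sigma> \<pi> n \<in> S_fin (n + 1)"
  using assms
  by (auto simp: S_omega_plus_one_def compatible_def derived_def S_fin_def nth_append
      less_Suc_eq simp del: upt_Suc)

end

theory Submission
  imports Defs
begin

text \<open>
  The sequence is read as an instruction for building \<open>A\<close> outwards from a point \<open>x\<close>.  For
  \<open>s \<in> \<S>(n + 2)\<close> the chain \<open>\<A>(s)\<close> is a sum over the integers of pieces (\<open>chain_of_int_sum\<close>):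
  all pieces are \<open>\<A>(s\<^sup>-)\<close> if the last entry of \<open>s\<close> is maximal, and otherwise there is a least
  piece, \<open>\<A>(s\<^sup>+)\<close>, followed by copies of \<open>\<A>(s\<^sup>-)\<close>.  Compatibility of \<open>(\<sigma>, \<pi>)\<close> implies that
  \<open>\<A>(s\<^sub>n)\<close> is one of the pieces of \<open>\<A>(s\<^sub>n\<^sub>+\<^sub>1)\<close>: the least one if \<open>\<pi>(n) = 0\<close>, and any piece that
  is not a least one if \<open>\<pi>(n) > 0\<close> (\<open>pieces_derived\<close>).  So every \<open>\<A>(s\<^sub>n)\<close> embeds as a convex subchain in the
  next one, and \<open>A\<close> is the union of this tower (\<open>limit_chain\<close>); its \<open>n\<close>-th stage is isomorphic to
  \<open>\<A>(s\<^sub>n)\<close> (\<open>stage_iso\<close>).  Three facts remain.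

  The stages are the components of \<open>x\<close> (\<open>rho_limit_chain\<close>).  On convex subchains the relations
  \<open>\<rho>\<^sub>n\<close> are the restrictions of those of the whole chain (\<open>rho_convex_embedding\<close>).  Call a chain
  of height \<open>n\<close> if \<open>\<rho>\<^sub>n\<close> relates all its elements and, for \<open>n > 0\<close>, there is no last
  \<open>\<rho>\<^sub>n\<^sub>-\<^sub>1\<close>-class.  A convex subchain of height \<open>n > 0\<close> meets infinitely many \<open>\<rho>\<^sub>n\<^sub>-\<^sub>1\<close>-classes
  above each of its elements, hence \<open>\<rho>\<^sub>n\<close> relates none of its elements to anything above it
  (\<open>not_rho_above_convex\<close>).  Therefore in a sum of pieces of height \<open>n\<close> the \<open>\<rho>\<^sub>n\<close>-classes are the
  pieces (\<open>rho_int_sum\<close>), the chains \<open>\<A>(s)\<close> have the expected height by induction, and a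
  \<open>\<rho>\<^sub>n\<close>-class of \<open>A\<close> cannot leave the \<open>n\<close>-th stage.

  The chain \<open>A\<close> has rank \<open>\<omega>\<close>: any two elements lie in a common stage, and no stage is everything.

  The chain \<open>A\<close> is uniform: two elements lie in a common stage, and what follows that stage is the
  same for both, so it suffices that every \<open>\<A>(s)\<close> is uniform.  More generally, the tails
  \<open>\<A>(s)\<^sup>\<ge>\<^sup>x\<close> depend, up to isomorphism, only on \<open>s\<^sup>-\<close> (\<open>tail_chain_of\<close>).  Indeed the piece of
  \<open>x\<close> is followed by \<open>\<A>(s\<^sup>-)\<nat>\<close> in every case, and the piece itself is \<open>\<A>(s\<^sup>-)\<close> or \<open>\<A>(s\<^sup>+)\<close>,
  where \<open>s\<^sup>-\<close> and \<open>s\<^sup>+\<close> differ at most in their last entry; induction applies.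
\<close>

section \<open>Chains, isomorphisms and convex embeddings\<close>

lemma chain_refl: "chain r \<Longrightarrow> x \<in> Field r \<Longrightarrow> (x, x) \<in> r"
  by (auto simp: order_on_defs refl_on_def)

lemma chain_trans: "chain r \<Longrightarrow> (x, y) \<in> r \<Longrightarrow> (y, z) \<in> r \<Longrightarrow> (x, z) \<in> r"
  by (auto simp: order_on_defs elim: transE)

lemma chain_antisym: "chain r \<Longrightarrow> (x, y) \<in> r \<Longrightarrow> (y, x) \<in> r \<Longrightarrow> x = y"
  by (auto simp: order_on_defs elim: antisymD)

lemma chain_total: "chain r \<Longrightarrow> x \<in> Field r \<Longrightarrow> y \<in> Field r \<Longrightarrow> (x, y) \<in> r \<or> (y, x) \<in> r"
  using chain_refl[of r x] by (cases "x = y") (auto simp: order_on_defs total_on_def)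

lemma FieldD: "(x, y) \<in> r \<Longrightarrow> x \<in> Field r" "(x, y) \<in> r \<Longrightarrow> y \<in> Field r"
  by (auto simp: Field_def)

lemma chainI:
  assumes "\<And>x. x \<in> Field r \<Longrightarrow> (x, x) \<in> r"
    and "\<And>x y z. (x, y) \<in> r \<Longrightarrow> (y, z) \<in> r \<Longrightarrow> (x, z) \<in> r"
    and "\<And>x y. (x, y) \<in> r \<Longrightarrow> (y, x) \<in> r \<Longrightarrow> x = y"
    and "\<And>x y. x \<in> Field r \<Longrightarrow> y \<in> Field r \<Longrightarrow> (x, y) \<in> r \<or> (y, x) \<in> r"
  shows "chain r"
  unfolding order_on_defs
  using assms by (auto simp: refl_on_def antisym_def total_on_def Field_def intro!: transI)

lemma Field_Restr_chain:
  assumes "chain r"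
  shows "Field (Restr r C) = Field r \<inter> C"
proof
  show "Field (Restr r C) \<subseteq> Field r \<inter> C" by (auto simp: Field_def)
  show "Field r \<inter> C \<subseteq> Field (Restr r C)"
  proof
    fix x assume "x \<in> Field r \<inter> C"
    then have "(x, x) \<in> Restr r C" using chain_refl[OF assms] by simp
    then show "x \<in> Field (Restr r C)" by (rule FieldD)
  qed
qed

lemma chain_Restr:
  assumes "chain r"
  shows "chain (Restr r C)"
proof (rule chainI)
  fix x y z
  show "(x, y) \<in> Restr r C \<Longrightarrow> (y, z) \<in> Restr r C \<Longrightarrow> (x, z) \<in> Restr r C"
    using chain_trans[OF assms] by blast
qed (use chain_refl[OF assms] chain_antisym[OF assms] chain_total[OF assms]
    in \<open>auto simp: Field_Restr_chain[OF assms]\<close>)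

text \<open>
  An order embedding of \<open>r\<close> onto a convex subset of \<open>s\<close>.  Injectivity is not demanded, since it
  follows from antisymmetry of \<open>r\<close>.
\<close>

definition convex_embedding :: "('a \<Rightarrow> 'b) \<Rightarrow> 'a rel \<Rightarrow> 'b rel \<Rightarrow> bool" where
  "convex_embedding f r s \<longleftrightarrow>
     (\<forall>x\<in>Field r. f x \<in> Field s) \<and>
     (\<forall>x\<in>Field r. \<forall>y\<in>Field r. (x, y) \<in> r \<longleftrightarrow> (f x, f y) \<in> s) \<and>
     (\<forall>x\<in>Field r. \<forall>z\<in>Field r. \<forall>y. (f x, y) \<in> s \<longrightarrow> (y, f z) \<in> s \<longrightarrow> y \<in> f ` Field r)"

lemma convex_embedding_inj:
  assumes "convex_embedding f r s" "chain r" "x \<in> Field r" "y \<in> Field r" "f x = f y"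
  shows "x = y"
  using assms chain_refl[of r] chain_antisym[of r x y] unfolding convex_embedding_def by metis

lemma chain_isoI:
  assumes "chain r" "f ` Field r = Field s"
    and "\<And>x y. x \<in> Field r \<Longrightarrow> y \<in> Field r \<Longrightarrow> (x, y) \<in> r \<longleftrightarrow> (f x, f y) \<in> s"
  shows "r \<cong>\<^sub>c s"
proof -
  have "inj_on f (Field r)"
    using assms chain_refl[of r] chain_antisym[of r] by (intro inj_onI) metis
  then show ?thesis
    unfolding chain_iso_def bij_betw_def using assms(2,3) by (intro exI[of _ f]) simp
qed

lemma chain_isoE:
  assumes "r \<cong>\<^sub>c s"
  obtains f where "f ` Field r = Field s" "inj_on f (Field r)"
    "\<forall>x\<in>Field r. \<forall>y\<in>Field r. (x, y) \<in> r \<longleftrightarrow> (f x, f y) \<in> s"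
proof -
  obtain f where f: "bij_betw f (Field r) (Field s)"
    "\<forall>x\<in>Field r. \<forall>y\<in>Field r. (x, y) \<in> r \<longleftrightarrow> (f x, f y) \<in> s"
    using assms unfolding chain_iso_def by blast
  show ?thesis by (rule that[of f]) (use f in \<open>simp_all add: bij_betw_def\<close>)
qed

lemma onto_convex_embedding:
  assumes "f ` Field r = Field s"
    and "\<And>x y. x \<in> Field r \<Longrightarrow> y \<in> Field r \<Longrightarrow> (x, y) \<in> r \<longleftrightarrow> (f x, f y) \<in> s"
  shows "convex_embedding f r s"
  unfolding convex_embedding_def
proof (intro conjI ballI allI impI)
  fix x y z assume "(f x, y) \<in> s"
  then show "y \<in> f ` Field r" unfolding assms(1) by (rule FieldD)
qed (use assms in \<open>simp_all, blast?\<close>)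

lemma chain_iso_refl: "r \<cong>\<^sub>c r"
  unfolding chain_iso_def by (rule exI[of _ id]) auto

lemma chain_iso_sym:
  assumes "r \<cong>\<^sub>c s" shows "s \<cong>\<^sub>c r"
proof -
  obtain f where f: "bij_betw f (Field r) (Field s)"
    "\<forall>x\<in>Field r. \<forall>y\<in>Field r. (x, y) \<in> r \<longleftrightarrow> (f x, f y) \<in> s"
    using assms unfolding chain_iso_def by blast
  have "bij_betw (inv_into (Field r) f) (Field s) (Field r)"
    using f(1) by (rule bij_betw_inv_into)
  moreover have "(x, y) \<in> s \<longleftrightarrow> (inv_into (Field r) f x, inv_into (Field r) f y) \<in> r"
    if "x \<in> Field s" "y \<in> Field s" for x y
  proof -
    let ?g = "inv_into (Field r) f"
    have "?g x \<in> Field r" "?g y \<in> Field r" using bij_betw_apply[OF calculation] that by blast+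
    then have "(?g x, ?g y) \<in> r \<longleftrightarrow> (f (?g x), f (?g y)) \<in> s" using f(2) by blast
    then show ?thesis using bij_betw_inv_into_right[OF f(1)] that by simp
  qed
  ultimately show ?thesis unfolding chain_iso_def by (intro exI conjI ballI) auto
qed

lemma chain_iso_trans:
  assumes "r \<cong>\<^sub>c s" "s \<cong>\<^sub>c t" shows "r \<cong>\<^sub>c t"
proof -
  obtain f where f: "bij_betw f (Field r) (Field s)"
    "\<forall>x\<in>Field r. \<forall>y\<in>Field r. (x, y) \<in> r \<longleftrightarrow> (f x, f y) \<in> s"
    using assms unfolding chain_iso_def by blast
  obtain g where g: "bij_betw g (Field s) (Field t)"
    "\<forall>x\<in>Field s. \<forall>y\<in>Field s. (x, y) \<in> s \<longleftrightarrow> (g x, g y) \<in> t"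
    using assms unfolding chain_iso_def by blast
  have "bij_betw (g \<circ> f) (Field r) (Field t)" using f g bij_betw_trans by blast
  moreover have "\<forall>x\<in>Field r. \<forall>y\<in>Field r. (x, y) \<in> r \<longleftrightarrow> ((g \<circ> f) x, (g \<circ> f) y) \<in> t"
    using f(2) g(2) bij_betw_apply[OF f(1)] by simp
  ultimately show ?thesis unfolding chain_iso_def by (intro exI conjI)
qed

lemma chain_iso_chain:
  assumes "r \<cong>\<^sub>c s" "chain s" shows "chain r"
proof -
  obtain f where f: "f ` Field r = Field s" "inj_on f (Field r)"
    "\<forall>x\<in>Field r. \<forall>y\<in>Field r. (x, y) \<in> r \<longleftrightarrow> (f x, f y) \<in> s"
    by (rule chain_isoE[OF assms(1)])
  show ?thesis
  proof (rule chainI)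
    fix x assume "x \<in> Field r"
    then show "(x, x) \<in> r" using f chain_refl[OF assms(2)] by blast
  next
    fix x y z assume "(x, y) \<in> r" "(y, z) \<in> r"
    then show "(x, z) \<in> r" using f(3) chain_trans[OF assms(2)] FieldD by metis
  next
    fix x y assume "(x, y) \<in> r" "(y, x) \<in> r"
    then show "x = y" using f(2,3) chain_antisym[OF assms(2)] FieldD by (metis inj_onD)
  next
    fix x y assume "x \<in> Field r" "y \<in> Field r"
    then show "(x, y) \<in> r \<or> (y, x) \<in> r" using f chain_total[OF assms(2)] by blast
  qed
qed

text \<open>The final segment \<open>r\<^sup>\<ge>\<^sup>x\<close>.\<close>

abbreviation tail :: "'a rel \<Rightarrow> 'a \<Rightarrow> 'a rel" where
  "tail r x \<equiv> Restr r (above r x)"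

lemma Restr_iso_Restr:
  assumes "chain r" "C \<subseteq> Field r"
    and "\<And>x y. x \<in> C \<Longrightarrow> y \<in> C \<Longrightarrow> (x, y) \<in> r \<longleftrightarrow> (f x, f y) \<in> s"
    and "chain s" "f ` C = D" "D \<subseteq> Field s"
  shows "Restr r C \<cong>\<^sub>c Restr s D"
proof (rule chain_isoI[where f = f])
  show "chain (Restr r C)" by (rule chain_Restr[OF assms(1)])
  have F: "Field (Restr r C) = C" "Field (Restr s D) = D"
    using Field_Restr_chain[OF assms(1), of C] Field_Restr_chain[OF assms(4), of D] assms(2,6)
    by blast+
  then show "f ` Field (Restr r C) = Field (Restr s D)" using assms(5) by simp
  show "(x, y) \<in> Restr r C \<longleftrightarrow> (f x, f y) \<in> Restr s D"
    if "x \<in> Field (Restr r C)" "y \<in> Field (Restr r C)" for x y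
    using that assms(3,5) unfolding F by blast
qed

lemma tail_iso:
  assumes "chain r" "chain s" "f ` Field r = Field s" "x \<in> Field r"
    and "\<And>x y. x \<in> Field r \<Longrightarrow> y \<in> Field r \<Longrightarrow> (x, y) \<in> r \<longleftrightarrow> (f x, f y) \<in> s"
  shows "tail r x \<cong>\<^sub>c tail s (f x)"
proof (rule Restr_iso_Restr[where f = f])
  show "f ` above r x = above s (f x)"
  proof
    show "f ` above r x \<subseteq> above s (f x)"
    proof
      fix y assume "y \<in> f ` above r x"
      then obtain z where z: "(x, z) \<in> r" "y = f z" by (auto simp: above_def)
      then show "y \<in> above s (f x)" using assms(4,5) FieldD(2)[OF z(1)] by (simp add: above_def)
    qed
    show "above s (f x) \<subseteq> f ` above r x"
    proof
      fix y assume y: "y \<in> above s (f x)"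
      then have "y \<in> f ` Field r" unfolding assms(3) by (auto simp: above_def Field_def)
      then obtain z where "z \<in> Field r" "y = f z" by blast
      then show "y \<in> f ` above r x"
        using y assms(4,5) by (simp add: above_def image_iff) blast
    qed
  qed
  show "above r x \<subseteq> Field r" "above s (f x) \<subseteq> Field s"
    by (auto simp: above_def Field_def)
  then show "(y, z) \<in> r \<longleftrightarrow> (f y, f z) \<in> s" if "y \<in> above r x" "z \<in> above r x" for y z
    using that assms(5) by blast
qed (rule assms(1,2))+

text \<open>Chains that split into two isomorphic pieces, one above the other, are isomorphic.\<close>

lemma chain_iso_glue:
  assumes r: "chain r" "B \<union> U \<subseteq> Field r" "\<And>b u. b \<in> B \<Longrightarrow> u \<in> U \<Longrightarrow> (b, u) \<in> r \<and> (u, b) \<notin> r"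
    and s: "chain s" "B' \<union> U' \<subseteq> Field s" "\<And>b u. b \<in> B' \<Longrightarrow> u \<in> U' \<Longrightarrow> (b, u) \<in> s \<and> (u, b) \<notin> s"
    and isos: "Restr r B \<cong>\<^sub>c Restr s B'" "Restr r U \<cong>\<^sub>c Restr s U'"
  shows "Restr r (B \<union> U) \<cong>\<^sub>c Restr s (B' \<union> U')"
proof -
  have F: "Field (Restr r B) = B" "Field (Restr r U) = U"
    "Field (Restr s B') = B'" "Field (Restr s U') = U'"
    using Field_Restr_chain[OF r(1)] Field_Restr_chain[OF s(1)] r(2) s(2) by blast+
  obtain f where f0: "f ` B = B'"
    "\<forall>x\<in>B. \<forall>y\<in>B. (x, y) \<in> Restr r B \<longleftrightarrow> (f x, f y) \<in> Restr s B'"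
    by (rule chain_isoE[OF isos(1), unfolded F])
  have f: "f ` B = B'" "(x, y) \<in> r \<longleftrightarrow> (f x, f y) \<in> s" if "x \<in> B" "y \<in> B" for x y
    using f0 that by auto
  obtain g where g0: "g ` U = U'"
    "\<forall>x\<in>U. \<forall>y\<in>U. (x, y) \<in> Restr r U \<longleftrightarrow> (g x, g y) \<in> Restr s U'"
    by (rule chain_isoE[OF isos(2), unfolded F])
  have g: "g ` U = U'" "(x, y) \<in> r \<longleftrightarrow> (g x, g y) \<in> s" if "x \<in> U" "y \<in> U" for x y
    using g0 that by auto
  have disj: "b \<notin> U" if "b \<in> B" for b using r(3) that by blast
  let ?h = "\<lambda>x. if x \<in> B then f x else g x"
  have B: "?h x = f x" "f x \<in> B'" if "x \<in> B" for x using f0(1) that by auto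
  have U: "?h x = g x" "g x \<in> U'" if "x \<in> U" for x using g0(1) that disj by auto
  show ?thesis
  proof (rule Restr_iso_Restr[where f = ?h])
    have "?h ` B = B'" "?h ` U = U'" using f0(1) g0(1) disj by (auto simp: image_iff)
    then show "?h ` (B \<union> U) = B' \<union> U'" unfolding image_Un by simp
    show "(x, y) \<in> r \<longleftrightarrow> (?h x, ?h y) \<in> s" if xy: "x \<in> B \<union> U" "y \<in> B \<union> U" for x y
    proof -
      consider "x \<in> B" "y \<in> B" | "x \<in> B" "y \<in> U" | "x \<in> U" "y \<in> B" | "x \<in> U" "y \<in> U"
        using xy by blast
      then show ?thesis
      proof cases
        case 1 then show ?thesis using f(2) B by simp
      next
        case 2
        then show ?thesis using r(3)[OF 2] s(3)[OF B(2)[OF 2(1)] U(2)[OF 2(2)]] B(1) U(1) by simp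
      next
        case 3
        then show ?thesis using r(3)[OF 3(2,1)] s(3)[OF B(2)[OF 3(2)] U(2)[OF 3(1)]] B(1) U(1) by simp
      next
        case 4
        then show ?thesis using g(2) U(1) by simp
      qed
    qed
  qed (rule r(1,2) s(1,2))+
qed

section \<open>The equivalence relations of finite index\<close>

text \<open>
  Finiteness of the image of a map depends only on its kernel.  This transfers finiteness of a
  set of classes between different equivalence relations.
\<close>

lemma finite_image_kernel:
  assumes "\<And>a b. a \<in> I \<Longrightarrow> b \<in> I \<Longrightarrow> f a = f b \<longleftrightarrow> g a = g b"
  shows "finite (f ` I) \<longleftrightarrow> finite (g ` I)"
proof -
  have aux: "finite (k ` I)" if "finite (h ` I)" and
    "\<And>a b. a \<in> I \<Longrightarrow> b \<in> I \<Longrightarrow> h a = h b \<Longrightarrow> k a = k b" for h :: "'a \<Rightarrow> 'x" and k :: "'a \<Rightarrow> 'y"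
  proof -
    have "k a = k (inv_into I h (h a))" if "a \<in> I" for a
      using that \<open>\<And>a b. a \<in> I \<Longrightarrow> b \<in> I \<Longrightarrow> h a = h b \<Longrightarrow> k a = k b\<close>
      by (metis f_inv_into_f image_eqI inv_into_into)
    then have "k ` I \<subseteq> (k \<circ> inv_into I h) ` (h ` I)" by force
    then show ?thesis using that(1) finite_surj by blast
  qed
  show ?thesis using aux[of f g] aux[of g f] assms by blast
qed

text \<open>
  An equivalence relation on the chain \<open>r\<close> with convex classes.  By symmetry it is enough to
  compare the intermediate element with the lower end of the interval.
\<close>

definition convex_equiv :: "'a rel \<Rightarrow> 'a rel \<Rightarrow> bool" where
  "convex_equiv r e \<longleftrightarrow> equiv (Field r) e \<and>
     (\<forall>x y z. (x, y) \<in> r \<longrightarrow> (y, z) \<in> r \<longrightarrow> (x, z) \<in> e \<longrightarrow> (x, y) \<in> e)"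

lemma between_subset_Field: "between r x y \<subseteq> Field r"
  by (auto simp: between_def dest: FieldD)

lemma between_commute: "between r x y = between r y x"
  by (auto simp: between_def)

text \<open>
  The interval between two classes consists of the classes that meet the interval between their
  representatives, so that \<open>\<rho>\<^sub>n\<^sub>+\<^sub>1\<close> can be computed without forming the quotient chain.
\<close>

lemma between_quotient:
  assumes r: "chain r" and e: "convex_equiv r e" and xy: "(x, y) \<in> r"
  shows "between (quotient_chain r e) (e `` {x}) (e `` {y}) = (\<lambda>z. e `` {z}) ` between r x y"
proof -
  have eq: "equiv (Field r) e" using e by (simp add: convex_equiv_def)
  have conv: "(a, b) \<in> e" if "(a, b) \<in> r" "(b, c) \<in> r" "(a, c) \<in> e" for a b c
    using e that unfolding convex_equiv_def by blast
  have cls: "e `` {a} = e `` {b} \<longleftrightarrow> (a, b) \<in> e" if "a \<in> Field r" "b \<in> Field r" for a b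
    using eq_equiv_class_iff[OF eq] that by blast
  have sym: "(b, a) \<in> e" if "(a, b) \<in> e" for a b using eq that by (meson equivE symD)
  have tr: "(a, c) \<in> e" if "(a, b) \<in> e" "(b, c) \<in> e" for a b c
    using eq that by (meson equivE transD)
  have qle: "(e `` {a}, e `` {b}) \<in> quotient_chain r e \<longleftrightarrow> (a, b) \<in> e \<or> (a, b) \<in> r"
    if ab: "a \<in> Field r" "b \<in> Field r" for a b
  proof
    assume "(e `` {a}, e `` {b}) \<in> quotient_chain r e"
    then obtain a' b' where *: "(a, a') \<in> e" "(b, b') \<in> e" "(a', b') \<in> r"
      by (auto simp: quotient_chain_def)
    show "(a, b) \<in> e \<or> (a, b) \<in> r"
    proof (rule ccontr)
      assume n: "\<not> ?thesis"
      then have ba: "(b, a) \<in> r" using chain_total[OF r] ab by blast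
      have F: "a' \<in> Field r" "b' \<in> Field r" using *(3) by (auto dest: FieldD)
      (* b < a, and a' <= b' lie in the classes of a and b, respectively *)
      show False
      proof (cases "(a, b') \<in> r")
        case True
        then show False using conv[OF ba True] * n sym by blast
      next
        case False
        then have "(b', a) \<in> r" using chain_total[OF r] ab F by blast
        then have "(a', b') \<in> e" using conv[OF *(3)] * sym by blast
        then show False using * n sym tr by blast
      qed
    qed
  next
    assume "(a, b) \<in> e \<or> (a, b) \<in> r"
    then show "(e `` {a}, e `` {b}) \<in> quotient_chain r e"
    proof
      assume ab': "(a, b) \<in> e"
      have "(a, a) \<in> e" "(b, a) \<in> e" "(a, a) \<in> r"
        using ab' sym tr chain_refl[OF r ab(1)] by blast+
      then show ?thesis using ab by (auto simp: quotient_chain_def quotient_def)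
    next
      assume ab': "(a, b) \<in> r"
      have "(a, a) \<in> e" "(b, b) \<in> e" using eq ab by (auto elim!: equivE dest: refl_onD)
      then show ?thesis using ab ab' by (auto simp: quotient_chain_def quotient_def)
    qed
  qed
  have xyF: "x \<in> Field r" "y \<in> Field r" using xy by (auto dest: FieldD)
  show ?thesis
  proof
    show "(\<lambda>z. e `` {z}) ` between r x y \<subseteq> between (quotient_chain r e) (e `` {x}) (e `` {y})"
    proof
      fix Z assume "Z \<in> (\<lambda>z. e `` {z}) ` between r x y"
      then obtain z where z: "z \<in> between r x y" "Z = e `` {z}" by blast
      then have "z \<in> Field r" using between_subset_Field by fast
      then show "Z \<in> between (quotient_chain r e) (e `` {x}) (e `` {y})"
        using z qle xyF unfolding between_def by blast
    qed
    show "between (quotient_chain r e) (e `` {x}) (e `` {y}) \<subseteq> (\<lambda>z. e `` {z}) ` between r x y"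
    proof
      fix Z assume Z: "Z \<in> between (quotient_chain r e) (e `` {x}) (e `` {y})"
      then have "Z \<in> Field r // e" by (auto simp: between_def quotient_chain_def)
      then obtain z where z: "z \<in> Field r" "Z = e `` {z}" by (auto elim: quotientE)
      have "x \<in> between r x y" "y \<in> between r x y"
        using xy xyF chain_refl[OF r] by (auto simp: between_def)
      then have *: "Z \<in> (\<lambda>z. e `` {z}) ` between r x y" if "(x, z) \<in> e \<or> (y, z) \<in> e"
        using that cls xyF z by (metis image_eqI)
      from Z consider "(x, z) \<in> e \<or> (x, z) \<in> r" "(z, y) \<in> e \<or> (z, y) \<in> r"
        | "(y, z) \<in> e \<or> (y, z) \<in> r" "(z, x) \<in> e \<or> (z, x) \<in> r"
        using qle xyF z by (auto simp: between_def)
      then show "Z \<in> (\<lambda>z. e `` {z}) ` between r x y"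
      proof cases
        case 1
        then show ?thesis using * z sym by (cases "(x, z) \<in> e \<or> (y, z) \<in> e") (auto simp: between_def)
      next
        case 2
        have "x = y" if "(y, x) \<in> r" using that xy chain_antisym[OF r] by blast
        then have "(x, z) \<in> e \<or> (y, z) \<in> e \<or> z \<in> between r x y"
          using 2 sym chain_trans[OF r, of y z x] unfolding between_def by blast
        then show ?thesis using * z by blast
      qed
    qed
  qed
qed

lemma rho_step_iff:
  assumes r: "chain r" and e: "convex_equiv r e"
  shows "(x, y) \<in> rho_step r e \<longleftrightarrow>
     x \<in> Field r \<and> y \<in> Field r \<and> finite ((\<lambda>z. e `` {z}) ` between r x y)"
proof (cases "x \<in> Field r \<and> y \<in> Field r")
  case True
  then consider "(x, y) \<in> r" | "(y, x) \<in> r" using chain_total[OF r] by blast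
  then show ?thesis
  proof cases
    case 1
    then show ?thesis using between_quotient[OF r e 1] by (simp add: rho_step_def)
  next
    case 2
    then show ?thesis using between_quotient[OF r e 2]
      by (simp add: rho_step_def between_commute[of _ "e `` {x}"] between_commute[of _ x])
  qed
qed (auto simp: rho_step_def)

lemma convex_equiv_rho_step:
  assumes r: "chain r" and e: "convex_equiv r e"
  shows "convex_equiv r (rho_step r e)"
  unfolding convex_equiv_def
proof (intro conjI allI impI equivI)
  note iff = rho_step_iff[OF r e]
  show "rho_step r e \<subseteq> Field r \<times> Field r" by (auto simp: iff)
  have "between r x x \<subseteq> {x}" for x using chain_antisym[OF r] by (auto simp: between_def)
  then have "finite (between r x x)" for x using finite_subset by blast
  then show "refl_on (Field r) (rho_step r e)" by (auto simp: refl_on_def iff)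
  show "sym (rho_step r e)" by (rule symI) (simp add: iff between_commute)
  show "trans (rho_step r e)"
  proof (rule transI)
    fix x y z assume *: "(x, y) \<in> rho_step r e" "(y, z) \<in> rho_step r e"
    have "between r x z \<subseteq> between r x y \<union> between r y z"
    proof
      fix w assume w: "w \<in> between r x z"
      then have "w \<in> Field r" using between_subset_Field by fast
      then have "(w, y) \<in> r \<or> (y, w) \<in> r" using * chain_total[OF r] by (auto simp: iff)
      then show "w \<in> between r x y \<union> between r y z" using w by (auto simp: between_def)
    qed
    then have "(\<lambda>z. e `` {z}) ` between r x z \<subseteq>
        (\<lambda>z. e `` {z}) ` between r x y \<union> (\<lambda>z. e `` {z}) ` between r y z" by blast
    then show "(x, z) \<in> rho_step r e" using * by (auto simp: iff dest: finite_subset)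
  qed
  fix x y z assume *: "(x, y) \<in> r" "(y, z) \<in> r" "(x, z) \<in> rho_step r e"
  have "between r x y \<subseteq> between r x z"
  proof
    fix w assume "w \<in> between r x y"
    then consider "(x, w) \<in> r" "(w, y) \<in> r" | "(y, w) \<in> r" "(w, x) \<in> r"
      by (auto simp: between_def)
    then show "w \<in> between r x z"
    proof cases
      case 1
      then show ?thesis using chain_trans[OF r, of w y z] *(2) unfolding between_def by blast
    next
      case 2
      then have "(x, w) \<in> r" using *(1) chain_trans[OF r] by blast
      then have "w = x" using 2 chain_antisym[OF r] by blast
      then show ?thesis
        using \<open>(x, w) \<in> r\<close> chain_trans[OF r *(1,2)] unfolding between_def by blast
    qed
  qed
  then have "(\<lambda>z. e `` {z}) ` between r x y \<subseteq> (\<lambda>z. e `` {z}) ` between r x z" by blast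
  then show "(x, y) \<in> rho_step r e" using * by (auto simp: iff dest: finite_subset FieldD)
qed

lemma convex_equiv_rho:
  assumes "chain r"
  shows "convex_equiv r (rho r (enat n))"
proof (induction n)
  case 0
  have "convex_equiv r (Id_on (Field r))"
    using chain_antisym[OF assms]
    by (auto simp: convex_equiv_def equiv_def refl_on_def sym_def trans_def dest: FieldD)
  then show ?case by (simp add: rho_enat_zero flip: zero_enat_def)
next
  case (Suc n)
  then show ?case using convex_equiv_rho_step[OF assms] by (simp add: rho_enat_Suc)
qed

lemma rho_Suc_iff:
  assumes "chain r"
  shows "(x, y) \<in> rho r (enat (Suc n)) \<longleftrightarrow>
     x \<in> Field r \<and> y \<in> Field r \<and> finite ((\<lambda>z. rho r (enat n) `` {z}) ` between r x y)"
  by (simp add: rho_enat_Suc rho_step_iff[OF assms convex_equiv_rho[OF assms]])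

lemma rho_0_iff: "(x, y) \<in> rho r (enat 0) \<longleftrightarrow> x \<in> Field r \<and> x = y"
  by (auto simp: rho_enat_zero simp flip: zero_enat_def)

context
  fixes r :: "'a rel"
  assumes r: "chain r"
begin

lemma rho_sym: "(x, y) \<in> rho r (enat n) \<Longrightarrow> (y, x) \<in> rho r (enat n)"
  using convex_equiv_rho[OF r, of n] by (auto simp: convex_equiv_def equiv_def sym_def)

lemma rho_trans: "(x, y) \<in> rho r (enat n) \<Longrightarrow> (y, z) \<in> rho r (enat n) \<Longrightarrow> (x, z) \<in> rho r (enat n)"
  using convex_equiv_rho[OF r, of n] unfolding convex_equiv_def by (meson equivE transD)

lemma rho_convex:
  "(x, y) \<in> r \<Longrightarrow> (y, z) \<in> r \<Longrightarrow> (x, z) \<in> rho r (enat n) \<Longrightarrow> (x, y) \<in> rho r (enat n)"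
  using convex_equiv_rho[OF r, of n] unfolding convex_equiv_def by blast

lemma rho_Field: "(x, y) \<in> rho r (enat n) \<Longrightarrow> x \<in> Field r \<and> y \<in> Field r"
  using convex_equiv_rho[OF r, of n] by (auto simp: convex_equiv_def equiv_def)

lemma rho_class_eq_iff:
  assumes "x \<in> Field r" "y \<in> Field r"
  shows "rho r (enat n) `` {x} = rho r (enat n) `` {y} \<longleftrightarrow> (x, y) \<in> rho r (enat n)"
  using convex_equiv_rho[OF r, of n] eq_equiv_class_iff[of "Field r"] assms
  unfolding convex_equiv_def by metis

lemma rho_mono_Suc:
  assumes "(x, y) \<in> rho r (enat n)"
  shows "(x, y) \<in> rho r (enat (Suc n))"
proof -
  have "rho r (enat n) `` {z} = rho r (enat n) `` {x}" if "z \<in> between r x y" for z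
  proof -
    have "(x, z) \<in> rho r (enat n)"
    proof (cases "(x, z) \<in> r \<and> (z, y) \<in> r")
      case True
      then show ?thesis using rho_convex assms by blast
    next
      case False
      then have "(y, z) \<in> r" "(z, x) \<in> r" using that by (auto simp: between_def)
      then have "(y, z) \<in> rho r (enat n)" using rho_convex rho_sym[OF assms] by blast
      then show ?thesis by (rule rho_trans[OF assms])
    qed
    then have "x \<in> Field r" "z \<in> Field r" using rho_Field by blast+
    then show ?thesis using \<open>(x, z) \<in> rho r (enat n)\<close> rho_class_eq_iff by metis
  qed
  then have "(\<lambda>z. rho r (enat n) `` {z}) ` between r x y \<subseteq> {rho r (enat n) `` {x}}" by blast
  then show ?thesis using rho_Field[OF assms] by (auto simp: rho_Suc_iff[OF r] dest: finite_subset)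
qed

lemma rho_mono: "m \<le> n \<Longrightarrow> (x, y) \<in> rho r (enat m) \<Longrightarrow> (x, y) \<in> rho r (enat n)"
  by (induction n rule: dec_induct) (auto intro: rho_mono_Suc)

end

text \<open>
  Intervals of a convex subchain are intervals of the whole chain, so by induction the relations
  \<open>\<rho>\<^sub>n\<close> of the subchain are restrictions.
\<close>

lemma rho_convex_embedding:
  assumes r: "chain r" and s: "chain s" and f: "convex_embedding f r s"
    and "x \<in> Field r" "y \<in> Field r"
  shows "(x, y) \<in> rho r (enat n) \<longleftrightarrow> (f x, f y) \<in> rho s (enat n)"
  using assms(4,5)
proof (induction n arbitrary: x y)
  case 0
  then show ?case using f convex_embedding_inj[OF f r] by (auto simp: rho_0_iff convex_embedding_def)
next
  case (Suc n)
  have fF: "f z \<in> Field s" if "z \<in> Field r" for z using f that by (auto simp: convex_embedding_def)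
  have ord: "(a, b) \<in> r \<longleftrightarrow> (f a, f b) \<in> s" if "a \<in> Field r" "b \<in> Field r" for a b
    using f that by (auto simp: convex_embedding_def)
  have img: "f ` between r x y = between s (f x) (f y)"
  proof
    show "f ` between r x y \<subseteq> between s (f x) (f y)"
      using ord Suc.prems by (auto simp: between_def dest: FieldD)
    show "between s (f x) (f y) \<subseteq> f ` between r x y"
    proof
      fix w assume w: "w \<in> between s (f x) (f y)"
      then obtain z where "z \<in> Field r" "w = f z"
        using f Suc.prems unfolding between_def convex_embedding_def by blast
      then show "w \<in> f ` between r x y" using w ord Suc.prems by (auto simp: between_def)
    qed
  qed
  have "finite ((\<lambda>z. rho r (enat n) `` {z}) ` between r x y) \<longleftrightarrow>
      finite ((\<lambda>z. rho s (enat n) `` {f z}) ` between r x y)"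
  proof (rule finite_image_kernel)
    fix a b assume "a \<in> between r x y" "b \<in> between r x y"
    then have ab: "a \<in> Field r" "b \<in> Field r" using between_subset_Field by fast+
    show "rho r (enat n) `` {a} = rho r (enat n) `` {b} \<longleftrightarrow>
        rho s (enat n) `` {f a} = rho s (enat n) `` {f b}"
      using Suc.IH[OF ab] ab fF by (simp add: rho_class_eq_iff r s)
  qed
  also have "(\<lambda>z. rho s (enat n) `` {f z}) ` between r x y =
      (\<lambda>z. rho s (enat n) `` {z}) ` between s (f x) (f y)"
    unfolding img[symmetric] by (simp add: image_image)
  finally show ?case using Suc.prems fF by (simp add: rho_Suc_iff r s)
qed

section \<open>Chains of finite height\<close>

text \<open>
  All elements are \<open>\<rho>\<^sub>n\<close>-related and, if \<open>n > 0\<close>, every element lies strictly below another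
  \<open>\<rho>\<^sub>n\<^sub>-\<^sub>1\<close>-class.  In particular the rank is \<open>n\<close>.
\<close>

definition has_height :: "nat \<Rightarrow> 'a rel \<Rightarrow> bool" where
  "has_height n r \<longleftrightarrow> Field r \<noteq> {} \<and> rho r (enat n) = Field r \<times> Field r \<and>
     (\<forall>k. n = Suc k \<longrightarrow> (\<forall>x\<in>Field r. \<exists>y. (x, y) \<in> r \<and> (x, y) \<notin> rho r (enat k)))"

lemma infinitely_many_classes_above:
  assumes r: "chain r" and x: "x \<in> Field r"
    and no_last: "\<And>x. x \<in> Field r \<Longrightarrow> \<exists>y. (x, y) \<in> r \<and> (x, y) \<notin> rho r (enat k)"
  shows "infinite ((\<lambda>z. rho r (enat k) `` {z}) ` above r x)"
proof
  let ?cls = "\<lambda>z. rho r (enat k) `` {z}"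
  assume "finite (?cls ` above r x)"
  (* representatives of the finitely many classes; a greatest representative would have to lie
     in the last class *)
  then obtain C where C: "C \<subseteq> above r x" "finite C" "?cls ` above r x = ?cls ` C"
    using finite_subset_image[of "?cls ` above r x" ?cls "above r x"] by auto
  have CF: "c \<in> Field r" "(x, c) \<in> r" if "c \<in> C" for c
    using C(1) that FieldD(2)[of x c r] by (auto simp: above_def)
  have "C = {}"
  proof (rule finite_transitivity_chain[OF C(2), where R = "\<lambda>a b. (a, b) \<in> r \<and> a \<noteq> b"])
    fix a assume a: "a \<in> C"
    obtain y where y: "(a, y) \<in> r" "(a, y) \<notin> rho r (enat k)" using no_last CF(1)[OF a] by blast
    have "y \<in> above r x" using chain_trans[OF r CF(2)[OF a] y(1)] by (simp add: above_def)
    then have "?cls y \<in> ?cls ` C" using C(3) by blast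
    then obtain c where c: "c \<in> C" "?cls y = ?cls c" by blast
    have yc: "(y, c) \<in> rho r (enat k)"
      using c(2) rho_class_eq_iff[OF r FieldD(2)[OF y(1)] CF(1)[OF c(1)]] by blast
    have "(c, a) \<notin> r"
    proof
      assume ca: "(c, a) \<in> r"
      have "(c, a) \<in> rho r (enat k)" by (rule rho_convex[OF r ca y(1) rho_sym[OF r yc]])
      then have "(y, a) \<in> rho r (enat k)" by (rule rho_trans[OF r yc])
      then show False using y(2) rho_sym[OF r] by blast
    qed
    then show "\<exists>b. b \<in> C \<and> (a, b) \<in> r \<and> a \<noteq> b"
      using chain_total[OF r CF(1)[OF a] CF(1)[OF c(1)]] chain_refl[OF r CF(1)[OF a]] c(1) by blast
  next
    fix a b c assume "(a, b) \<in> r \<and> a \<noteq> b" "(b, c) \<in> r \<and> b \<noteq> c"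
    then show "(a, c) \<in> r \<and> a \<noteq> c" using chain_trans[OF r] chain_antisym[OF r] by metis
  qed simp
  moreover have "x \<in> above r x" using chain_refl[OF r x] by (simp add: above_def)
  ultimately show False using C(3) by blast
qed

lemma not_rho_above_convex:
  assumes r: "chain r" and s: "chain s" and f: "convex_embedding f r s" and h: "has_height n r"
    and x: "x \<in> Field r" and y: "(f x, y) \<in> s" "y \<notin> f ` Field r"
  shows "(f x, y) \<notin> rho s (enat n)"
proof (cases n)
  case 0
  then show ?thesis using x y(2) by (auto simp: rho_0_iff)
next
  case (Suc k)
  have fF: "f z \<in> Field s" if "z \<in> Field r" for z using f that by (simp add: convex_embedding_def)
  have aF: "z \<in> Field r" "(x, z) \<in> r" if "z \<in> above r x" for z
    using that FieldD(2)[of x z r] by (simp_all add: above_def)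
  have "infinite ((\<lambda>z. rho r (enat k) `` {z}) ` above r x)"
    using h Suc by (intro infinitely_many_classes_above[OF r x]) (simp add: has_height_def)
  also have "finite ((\<lambda>z. rho r (enat k) `` {z}) ` above r x) \<longleftrightarrow>
      finite ((\<lambda>z. rho s (enat k) `` {f z}) ` above r x)"
  proof (rule finite_image_kernel)
    fix a b assume "a \<in> above r x" "b \<in> above r x"
    then have ab: "a \<in> Field r" "b \<in> Field r" using aF by blast+
    show "rho r (enat k) `` {a} = rho r (enat k) `` {b} \<longleftrightarrow>
        rho s (enat k) `` {f a} = rho s (enat k) `` {f b}"
      using rho_convex_embedding[OF r s f ab] ab fF by (simp add: rho_class_eq_iff r s)
  qed
  also have "(\<lambda>z. rho s (enat k) `` {f z}) ` above r x = (\<lambda>z. rho s (enat k) `` {z}) ` f ` above r x"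
    by (simp add: image_image)
  finally have "infinite ((\<lambda>z. rho s (enat k) `` {z}) ` f ` above r x)" .
  moreover have "f ` above r x \<subseteq> between s (f x) y"
  proof
    fix w assume "w \<in> f ` above r x"
    then obtain z where z: "z \<in> above r x" "w = f z" by blast
    have "(f x, f z) \<in> s" using f x aF[OF z(1)] by (simp add: convex_embedding_def)
    moreover have "(y, f z) \<notin> s"
      using f x aF(1)[OF z(1)] y unfolding convex_embedding_def by blast
    then have "(f z, y) \<in> s"
      using chain_total[OF s fF[OF aF(1)[OF z(1)]] FieldD(2)[OF y(1)]] by blast
    ultimately show "w \<in> between s (f x) y" by (simp add: z between_def)
  qed
  ultimately have "infinite ((\<lambda>z. rho s (enat k) `` {z}) ` between s (f x) y)"
    using finite_subset image_mono by metis
  then show ?thesis by (simp add: Suc rho_Suc_iff[OF s])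
qed

lemma has_height_iso:
  assumes s: "chain s" and rs: "r \<cong>\<^sub>c s" and h: "has_height n s"
  shows "has_height n r"
proof -
  have r: "chain r" by (rule chain_iso_chain[OF rs s])
  obtain f where f: "f ` Field r = Field s" "inj_on f (Field r)"
    "\<forall>x\<in>Field r. \<forall>y\<in>Field r. (x, y) \<in> r \<longleftrightarrow> (f x, f y) \<in> s"
    by (rule chain_isoE[OF rs])
  have emb: "convex_embedding f r s" using f by (intro onto_convex_embedding) auto
  note rho = rho_convex_embedding[OF r s emb]
  have fF: "f x \<in> Field s" if "x \<in> Field r" for x using f(1) that by blast
  show ?thesis unfolding has_height_def
  proof (intro conjI allI impI ballI)
    show "Field r \<noteq> {}" using h f(1) by (auto simp: has_height_def)
    show "rho r (enat n) = Field r \<times> Field r"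
    proof (intro equalityI subrelI)
      fix x y
      show "(x, y) \<in> rho r (enat n) \<Longrightarrow> (x, y) \<in> Field r \<times> Field r" using rho_Field[OF r] by blast
      assume "(x, y) \<in> Field r \<times> Field r"
      then have xy: "x \<in> Field r" "y \<in> Field r" by blast+
      show "(x, y) \<in> rho r (enat n)" using rho[OF xy, of n] fF[OF xy(1)] fF[OF xy(2)] h
        by (simp add: has_height_def)
    qed
    fix k x assume k: "n = Suc k" and x: "x \<in> Field r"
    then obtain y where y: "(f x, y) \<in> s" "(f x, y) \<notin> rho s (enat k)"
      using h fF[OF x] unfolding has_height_def by metis
    then obtain z where z: "z \<in> Field r" "y = f z" using FieldD(2)[OF y(1)] f(1) by blast
    show "\<exists>y. (x, y) \<in> r \<and> (x, y) \<notin> rho r (enat k)"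
      using y rho[OF x z(1), of k] f(3) x z by (intro exI[of _ z]) simp
  qed
qed

section \<open>Sums of chains over the integers\<close>

text \<open>
  The ordered sum \<open>\<Sum>\<^sub>k P(k)\<close> over \<open>k \<in> \<int>\<close>, the index being compared first.  Pieces may be empty,
  so that sums over a final segment of \<open>\<int>\<close> are included.
\<close>

definition int_sum :: "(int \<Rightarrow> 'a rel) \<Rightarrow> (int \<times> 'a) rel" where
  "int_sum P = {((k, a), (l, b)) | k a l b.
     a \<in> Field (P k) \<and> b \<in> Field (P l) \<and> (k < l \<or> k = l \<and> (a, b) \<in> P k)}"

lemma int_sum_iff:
  "((k, a), (l, b)) \<in> int_sum P \<longleftrightarrow>
     a \<in> Field (P k) \<and> b \<in> Field (P l) \<and> (k < l \<or> k = l \<and> (a, b) \<in> P k)"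
  by (simp add: int_sum_def)

context
  fixes P :: "int \<Rightarrow> 'a rel"
  assumes P: "\<And>k. chain (P k)"
begin

lemma Field_int_sum: "(k, a) \<in> Field (int_sum P) \<longleftrightarrow> a \<in> Field (P k)"
proof
  show "(k, a) \<in> Field (int_sum P) \<Longrightarrow> a \<in> Field (P k)"
    by (auto simp: Field_def int_sum_def)
  assume "a \<in> Field (P k)"
  then have "((k, a), (k, a)) \<in> int_sum P" by (simp add: int_sum_iff chain_refl[OF P])
  then show "(k, a) \<in> Field (int_sum P)" by (rule FieldD)
qed

lemma chain_int_sum: "chain (int_sum P)"
proof (rule chainI)
  fix x y z :: "int \<times> 'a"
  obtain k a l b m c where e: "x = (k, a)" "y = (l, b)" "z = (m, c)" by (cases x, cases y, cases z)
  show "x \<in> Field (int_sum P) \<Longrightarrow> (x, x) \<in> int_sum P"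
    by (simp add: e Field_int_sum int_sum_iff chain_refl[OF P])
  show "(x, y) \<in> int_sum P \<Longrightarrow> (y, z) \<in> int_sum P \<Longrightarrow> (x, z) \<in> int_sum P"
    using chain_trans[OF P[of k], of a b c] by (auto simp: e int_sum_iff)
  show "(x, y) \<in> int_sum P \<Longrightarrow> (y, x) \<in> int_sum P \<Longrightarrow> x = y"
    using chain_antisym[OF P[of k], of a b] by (auto simp: e int_sum_iff)
  show "x \<in> Field (int_sum P) \<Longrightarrow> y \<in> Field (int_sum P) \<Longrightarrow> (x, y) \<in> int_sum P \<or> (y, x) \<in> int_sum P"
    using chain_total[OF P[of k], of a b] by (auto simp: e int_sum_iff Field_int_sum)
qed

lemma int_sum_embedding: "convex_embedding (Pair k) (P k) (int_sum P)"
  by (auto simp: convex_embedding_def Field_int_sum int_sum_iff)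

lemma rho_int_sum:
  assumes h: "\<And>k. Field (P k) \<noteq> {} \<Longrightarrow> has_height n (P k)"
    and a: "a \<in> Field (P k)" and b: "b \<in> Field (P l)"
  shows "((k, a), (l, b)) \<in> rho (int_sum P) (enat n) \<longleftrightarrow> k = l"
proof -
  have less: "((k, a), (l, b)) \<notin> rho (int_sum P) (enat n)"
    if "k < l" "a \<in> Field (P k)" "b \<in> Field (P l)" for k l a b
    using that h[of k]
    by (intro not_rho_above_convex[OF P chain_int_sum int_sum_embedding]) (auto simp: int_sum_iff)
  have "((k, a), (k, b)) \<in> rho (int_sum P) (enat n)" if "k = l"
    using rho_convex_embedding[OF P chain_int_sum int_sum_embedding, of a k b n] a b that h[of k]
    by (auto simp: has_height_def)
  then show ?thesis
    using less[of k l a b] less[of l k b a] a b rho_sym[OF chain_int_sum] by (meson not_less_iff_gr_or_eq)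
qed

lemma has_height_int_sum:
  assumes h: "\<And>k. Field (P k) \<noteq> {} \<Longrightarrow> has_height n (P k)"
    and ne: "Field (P i) \<noteq> {}" and up: "\<And>k. Field (P k) \<noteq> {} \<Longrightarrow> Field (P (k + 1)) \<noteq> {}"
  shows "has_height (Suc n) (int_sum P)"
  unfolding has_height_def
proof (intro conjI allI impI ballI)
  note rho = rho_int_sum[OF h]
  let ?cls = "\<lambda>z. rho (int_sum P) (enat n) `` {z}"
  show "Field (int_sum P) \<noteq> {}" using ne Field_int_sum by blast
  have "(x, y) \<in> rho (int_sum P) (enat (Suc n))"
    if xy: "x \<in> Field (int_sum P)" "y \<in> Field (int_sum P)" for x y
  proof -
    (* only the pieces with index between those of x and y occur *)
    have "finite (?cls ` between (int_sum P) x y) \<longleftrightarrow> finite (fst ` between (int_sum P) x y)"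
    proof (rule finite_image_kernel)
      fix u v assume uv: "u \<in> between (int_sum P) x y" "v \<in> between (int_sum P) x y"
      obtain k a l b where e: "u = (k, a)" "v = (l, b)" by (cases u, cases v)
      have F: "u \<in> Field (int_sum P)" "v \<in> Field (int_sum P)"
        using uv between_subset_Field by fast+
      have "?cls u = ?cls v \<longleftrightarrow> (u, v) \<in> rho (int_sum P) (enat n)"
        by (rule rho_class_eq_iff[OF chain_int_sum F])
      also have "\<dots> \<longleftrightarrow> fst u = fst v" using F rho by (simp add: e Field_int_sum)
      finally show "?cls u = ?cls v \<longleftrightarrow> fst u = fst v" .
    qed
    moreover have "fst ` between (int_sum P) x y \<subseteq> {fst x..fst y} \<union> {fst y..fst x}"
      by (auto simp: between_def int_sum_def)
    then have "finite (fst ` between (int_sum P) x y)" by (rule finite_subset) simp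
    ultimately show ?thesis using xy by (simp add: rho_Suc_iff[OF chain_int_sum])
  qed
  then show "rho (int_sum P) (enat (Suc n)) = Field (int_sum P) \<times> Field (int_sum P)"
    using rho_Field[OF chain_int_sum] by (intro equalityI subrelI) blast+
  fix k x assume k: "Suc n = Suc k" and x: "x \<in> Field (int_sum P)"
  obtain l a where e: "x = (l, a)" by (cases x)
  have a: "a \<in> Field (P l)" using x by (simp add: e Field_int_sum)
  then obtain b where b: "b \<in> Field (P (l + 1))" using up by blast
  show "\<exists>y. (x, y) \<in> int_sum P \<and> (x, y) \<notin> rho (int_sum P) (enat k)"
    using a b k rho[OF _ a b] by (intro exI[of _ "(l + 1, b)"]) (simp add: e int_sum_iff)
qed

text \<open>
  The tail at an element splits into its tail within its own piece and the later pieces.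
\<close>

lemma tail_int_sum:
  assumes a: "a \<in> Field (P k)"
  shows "above (int_sum P) (k, a) = Pair k ` above (P k) a \<union> {x \<in> Field (int_sum P). k < fst x}"
    and "Restr (int_sum P) (Pair k ` above (P k) a) \<cong>\<^sub>c tail (P k) a"
proof -
  have ab: "b \<in> Field (P k)" if "b \<in> above (P k) a" for b
    using that FieldD(2)[of a b] by (simp add: above_def)
  show "above (int_sum P) (k, a) = Pair k ` above (P k) a \<union> {x \<in> Field (int_sum P). k < fst x}"
    using a ab by (auto simp: above_def int_sum_iff Field_int_sum image_iff)
  show "Restr (int_sum P) (Pair k ` above (P k) a) \<cong>\<^sub>c tail (P k) a"
  proof (rule Restr_iso_Restr[where f = snd, OF chain_int_sum])
    show "Pair k ` above (P k) a \<subseteq> Field (int_sum P)" using ab by (auto simp: Field_int_sum)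
    show "(x, y) \<in> int_sum P \<longleftrightarrow> (snd x, snd y) \<in> P k"
      if "x \<in> Pair k ` above (P k) a" "y \<in> Pair k ` above (P k) a" for x y
      using that ab by (auto simp: int_sum_iff)
    show "chain (P k)" by (rule P)
    show "snd ` Pair k ` above (P k) a = above (P k) a" by (simp add: image_image)
  qed (use ab in blast)
qed

end

text \<open>
  Above the piece of a given element only a sum of copies of the same chain follows, so that
  the tail at that element depends only on this chain and on the tail within the piece.
\<close>

lemma tail_int_sum_iso:
  assumes P: "\<And>k. chain (P k)" and Q: "\<And>k. chain (Q k)"
    and a: "a \<in> Field (P k)" and b: "b \<in> Field (Q l)" and ab: "tail (P k) a \<cong>\<^sub>c tail (Q l) b"
    and Pr: "\<And>i. k < i \<Longrightarrow> P i = r" and Qr: "\<And>i. l < i \<Longrightarrow> Q i = r"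
  shows "tail (int_sum P) (k, a) \<cong>\<^sub>c tail (int_sum Q) (l, b)"
  unfolding tail_int_sum(1)[of P, OF P a] tail_int_sum(1)[of Q, OF Q b]
proof (rule chain_iso_glue)
  note cP = chain_int_sum[of P, OF P] and FP = Field_int_sum[of P, OF P]
  note cQ = chain_int_sum[of Q, OF Q] and FQ = Field_int_sum[of Q, OF Q]
  show "chain (int_sum P)" "chain (int_sum Q)" by (rule cP, rule cQ)
  show "Restr (int_sum P) (Pair k ` above (P k) a) \<cong>\<^sub>c Restr (int_sum Q) (Pair l ` above (Q l) b)"
    using tail_int_sum(2)[of P, OF P a] tail_int_sum(2)[of Q, OF Q b] ab
    by (meson chain_iso_sym chain_iso_trans)
  show "Restr (int_sum P) {x \<in> Field (int_sum P). k < fst x} \<cong>\<^sub>c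
      Restr (int_sum Q) {x \<in> Field (int_sum Q). l < fst x}"
  proof (rule Restr_iso_Restr[where f = "\<lambda>x. (fst x + (l - k), snd x)", OF cP _ _ cQ])
    show "(\<lambda>x. (fst x + (l - k), snd x)) ` {x \<in> Field (int_sum P). k < fst x} =
        {x \<in> Field (int_sum Q). l < fst x}" (is "?f ` ?A = ?B")
    proof
      show "?f ` ?A \<subseteq> ?B" by (auto simp: FP FQ Pr Qr)
      show "?B \<subseteq> ?f ` ?A"
      proof
        fix y assume "y \<in> ?B"
        then have "(fst y + (k - l), snd y) \<in> ?A" "y = ?f (fst y + (k - l), snd y)"
          by (cases y, simp_all add: FP FQ Pr Qr)
        then show "y \<in> ?f ` ?A" by blast
      qed
    qed
    show "(x, y) \<in> int_sum P \<longleftrightarrow> (?f x, ?f y) \<in> int_sum Q" if "x \<in> ?A" "y \<in> ?A" for x y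
      using that by (cases x, cases y) (auto simp: int_sum_iff FP Pr Qr)
  qed auto
  show "Pair k ` above (P k) a \<union> {x \<in> Field (int_sum P). k < fst x} \<subseteq> Field (int_sum P)"
    unfolding tail_int_sum(1)[of P, OF P a, symmetric] by (auto simp: above_def Field_def)
  show "Pair l ` above (Q l) b \<union> {x \<in> Field (int_sum Q). l < fst x} \<subseteq> Field (int_sum Q)"
    unfolding tail_int_sum(1)[of Q, OF Q b, symmetric] by (auto simp: above_def Field_def)
  show "(u, v) \<in> int_sum P \<and> (v, u) \<notin> int_sum P"
    if "u \<in> Pair k ` above (P k) a" "v \<in> {x \<in> Field (int_sum P). k < fst x}" for u v
    using that FieldD(2)[of a _ "P k"] by (cases v) (auto simp: int_sum_iff FP above_def)
  show "(u, v) \<in> int_sum Q \<and> (v, u) \<notin> int_sum Q"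
    if "u \<in> Pair l ` above (Q l) b" "v \<in> {x \<in> Field (int_sum Q). l < fst x}" for u v
    using that FieldD(2)[of b _ "Q l"] by (cases v) (auto simp: int_sum_iff FQ above_def)
qed

section \<open>The chains A(s)\<close>

text \<open>
  The pieces of \<open>\<A>(s)\<close> as a sum over the integers.  If the last entry of \<open>s\<close> is not maximal, the
  indices start with \<open>0\<close>, and the piece of index \<open>0\<close> is \<open>\<A>(s\<^sup>+)\<close>.
\<close>

definition pieces :: "enat list \<Rightarrow> int \<Rightarrow> nat rel" where
  "pieces s k =
     (if last s = enat (length s - 1) then chain_of (seq_minus s)
      else if k < 0 then {}
      else if k = 0 then chain_of (seq_plus s)
      else chain_of (seq_minus s))"

lemma S_fin_last: "s \<in> S_fin (Suc n) \<Longrightarrow> last s = s ! n \<and> last s \<le> enat n \<and> length s = Suc n"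
  by (cases s rule: rev_cases) (auto simp: S_fin_def nth_append)

lemma seq_minus_S_fin: "s \<in> S_fin (Suc n) \<Longrightarrow> seq_minus s \<in> S_fin n"
  by (auto simp: S_fin_def seq_minus_def nth_butlast)

lemma seq_plus_S_fin:
  assumes "s \<in> S_fin (Suc (Suc n))" "last s \<noteq> enat (Suc n)"
  shows "seq_plus s \<in> S_fin (Suc n)"
proof -
  have "last s < enat (Suc n)" using assms(2) S_fin_last[OF assms(1)] by (metis order_less_le)
  then have "last s \<le> enat n" by (cases "last s") auto
  moreover have "seq_minus (seq_minus s) \<in> S_fin n" using assms(1) by (intro seq_minus_S_fin)
  ultimately show ?thesis
    by (auto simp: S_fin_def seq_plus_def seq_minus_def nth_append less_Suc_eq)
qed

lemma chain_prod_int_chain: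
  assumes r: "chain r"
  shows "chain_prod r int_chain \<cong>\<^sub>c int_sum (\<lambda>_. r)"
proof (rule chain_iso_sym, rule chain_isoI)
  let ?f = "\<lambda>(k, a). (a, k)"
  have F: "Field (chain_prod r int_chain) = Field r \<times> UNIV"
  proof
    show "Field (chain_prod r int_chain) \<subseteq> Field r \<times> UNIV" by (auto simp: Field_def chain_prod_def)
    show "Field r \<times> UNIV \<subseteq> Field (chain_prod r int_chain)"
    proof
      fix x :: "'a \<times> int" assume "x \<in> Field r \<times> UNIV"
      then have "(x, x) \<in> chain_prod r int_chain"
        using chain_refl[OF r] by (auto simp: chain_prod_def int_chain_def)
      then show "x \<in> Field (chain_prod r int_chain)" by (rule FieldD)
    qed
  qed
  note FS = Field_int_sum[of "\<lambda>_. r", OF r]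
  show "chain (int_sum (\<lambda>_. r))" by (rule chain_int_sum[OF r])
  show "?f ` Field (int_sum (\<lambda>_. r)) = Field (chain_prod r int_chain)"
    by (force simp: F FS)
  show "(x, y) \<in> int_sum (\<lambda>_. r) \<longleftrightarrow> (?f x, ?f y) \<in> chain_prod r int_chain"
    if "x \<in> Field (int_sum (\<lambda>_. r))" "y \<in> Field (int_sum (\<lambda>_. r))" for x y
    using that by (cases x, cases y) (auto simp: FS int_sum_iff chain_prod_def int_chain_def)
qed

lemma chain_sum_nat_chain:
  assumes r: "chain r" and q: "chain q"
  shows "chain_sum r (chain_prod q nat_chain) \<cong>\<^sub>c
     int_sum (\<lambda>k. if k < 0 then {} else if k = 0 then r else q)" (is "?S \<cong>\<^sub>c int_sum ?P")
proof (rule chain_iso_sym, rule chain_isoI)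
  let ?f = "\<lambda>(k, a). if k = 0 then Inl a else Inr (a, nat (k - 1))"
  have P: "chain (?P k)" for k using r q chainI[of "{}"] by simp
  have Fq: "Field (chain_prod q nat_chain) = Field q \<times> UNIV"
  proof
    show "Field (chain_prod q nat_chain) \<subseteq> Field q \<times> UNIV" by (auto simp: Field_def chain_prod_def)
    show "Field q \<times> UNIV \<subseteq> Field (chain_prod q nat_chain)"
    proof
      fix x :: "'a \<times> nat" assume "x \<in> Field q \<times> UNIV"
      then have "(x, x) \<in> chain_prod q nat_chain"
        using chain_refl[OF q] by (auto simp: chain_prod_def nat_chain_def)
      then show "x \<in> Field (chain_prod q nat_chain)" by (rule FieldD)
    qed
  qed
  have "Field ?S \<subseteq> Inl ` Field r \<union> Inr ` Field (chain_prod q nat_chain)"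
    by (auto simp: Field_def chain_sum_def)
  moreover have "Inl a \<in> Field ?S" if "a \<in> Field r" for a
    using chain_refl[OF r that] by (auto intro!: FieldD(1)[of "Inl a" "Inl a"] simp: chain_sum_def)
  moreover have "Inr (a, n) \<in> Field ?S" if "a \<in> Field q" for a n
    using chain_refl[OF q that] that
    by (auto intro!: FieldD(1)[of "Inr (a, n)" "Inr (a, n)"]
        simp: chain_sum_def chain_prod_def nat_chain_def)
  ultimately have F: "Field ?S = Inl ` Field r \<union> Inr ` (Field q \<times> UNIV)"
    unfolding Fq by auto
  note FS = Field_int_sum[of ?P, OF P]
  show "chain (int_sum ?P)" by (rule chain_int_sum[OF P])
  show "?f ` Field (int_sum ?P) = Field ?S"
  proof
    show "?f ` Field (int_sum ?P) \<subseteq> Field ?S" by (auto simp: F FS split: if_splits)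
    have "Inl a \<in> ?f ` Field (int_sum ?P)" if "a \<in> Field r" for a
      using that by (intro image_eqI[of _ _ "(0, a)"]) (auto simp: FS)
    moreover have "Inr (a, n) \<in> ?f ` Field (int_sum ?P)" if "a \<in> Field q" for a n
      using that by (intro image_eqI[of _ _ "(int n + 1, a)"]) (auto simp: FS)
    ultimately show "Field ?S \<subseteq> ?f ` Field (int_sum ?P)" by (auto simp: F)
  qed
  show "(x, y) \<in> int_sum ?P \<longleftrightarrow> (?f x, ?f y) \<in> ?S"
    if xy: "x \<in> Field (int_sum ?P)" "y \<in> Field (int_sum ?P)" for x y
  proof -
    obtain k a l b where e: "x = (k, a)" "y = (l, b)" by (cases x, cases y)
    have "k \<ge> 0" "l \<ge> 0" using xy by (auto simp: e FS split: if_splits)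
    then consider "k = 0" "l = 0" | "k = 0" "l > 0" | "k > 0" "l = 0" | "k > 0" "l > 0" by linarith
    then show ?thesis
    proof cases
      case 4
      then have "nat (k - 1) \<le> nat (l - 1) \<longleftrightarrow> k \<le> l" "nat (k - 1) = nat (l - 1) \<longleftrightarrow> k = l"
        by linarith+
      then show ?thesis
        using 4 xy by (auto simp: e FS int_sum_iff chain_sum_def chain_prod_def nat_chain_def)
    qed (use xy in \<open>auto simp: e FS int_sum_iff chain_sum_def Fq\<close>)
  qed
qed

lemma chain_of_int_sum:
  assumes s: "s \<in> S_fin (Suc (Suc n))"
    and IH: "\<And>t. t \<in> S_fin (Suc n) \<Longrightarrow> chain (chain_of t)"
  shows "chain (pieces s k)" "chain_of s \<cong>\<^sub>c int_sum (pieces s)"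
proof -
  have l: "length s = Suc n + 1" "s ! Suc n = last s" "last s \<le> enat (Suc n)"
    using S_fin_last[OF s] by auto
  have minus: "chain (chain_of (seq_minus s))" by (rule IH[OF seq_minus_S_fin[OF s]])
  show c: "chain (pieces s k)" for k
    using minus IH[OF seq_plus_S_fin[OF s]] chainI[of "{}"] l(1) by (simp add: pieces_def)
  show "chain_of s \<cong>\<^sub>c int_sum (pieces s)"
  proof (cases "last s = enat (Suc n)")
    case True
    then have "pieces s = (\<lambda>_. chain_of (seq_minus s))" using l(1) by (simp add: pieces_def fun_eq_iff)
    then show ?thesis
      using chain_of_eq[OF l(1)] chain_prod_int_chain[OF minus] chain_iso_trans l(2) True by simp
  next
    case False
    then have "pieces s = (\<lambda>k. if k < 0 then {} else if k = 0 then chain_of (seq_plus s)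
        else chain_of (seq_minus s))" using l(1) by (simp add: pieces_def fun_eq_iff)
    then show ?thesis
      using chain_of_less[OF l(1)] chain_sum_nat_chain[OF IH[OF seq_plus_S_fin[OF s False]] minus]
        chain_iso_trans l(2,3) False by (simp add: order_less_le)
  qed
qed

lemma pieces_cases:
  assumes s: "s \<in> S_fin (Suc (Suc n))" and k: "Field (pieces s k) \<noteq> {}"
  obtains t where "t \<in> S_fin (Suc n)" "pieces s k = chain_of t"
    "seq_minus t = seq_minus (seq_minus s)"
proof -
  have "seq_minus (seq_plus s) = seq_minus (seq_minus s)"
    by (simp add: seq_minus_def seq_plus_def)
  then show ?thesis
    using k that[of "seq_minus s"] that[of "seq_plus s"] seq_minus_S_fin[OF s] seq_plus_S_fin[OF s]
      S_fin_last[OF s] by (auto simp: pieces_def split: if_splits)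
qed

lemma one_chain: "chain one_chain" "has_height 0 one_chain"
  by (auto intro!: chainI simp: one_chain_def Field_def has_height_def rho_enat_zero
      simp flip: zero_enat_def)

lemma chain_of_S_fin_1: "s \<in> S_fin (Suc 0) \<Longrightarrow> chain_of s = one_chain"
  by (subst chain_of.simps) (simp add: S_fin_def)

lemma chain_of_chain_height:
  "s \<in> S_fin (Suc n) \<Longrightarrow> chain (chain_of s) \<and> has_height n (chain_of s)"
proof (induction n arbitrary: s)
  case 0
  then show ?case using one_chain by (simp add: chain_of_S_fin_1)
next
  case (Suc n)
  note c = chain_of_int_sum[OF Suc.prems conjunct1[OF Suc.IH]]
  have minus: "Field (chain_of (seq_minus s)) \<noteq> {}"
    using Suc.IH[OF seq_minus_S_fin[OF Suc.prems]] by (simp add: has_height_def)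
  have "has_height (Suc n) (int_sum (pieces s))"
  proof (rule has_height_int_sum[OF c(1)])
    show "Field (pieces s k) \<noteq> {} \<Longrightarrow> has_height n (pieces s k)" for k
      using pieces_cases[OF Suc.prems, of k] Suc.IH by metis
    show "Field (pieces s 1) \<noteq> {}" using minus by (simp add: pieces_def)
    show "Field (pieces s k) \<noteq> {} \<Longrightarrow> Field (pieces s (k + 1)) \<noteq> {}" for k
      using minus by (auto simp: pieces_def split: if_splits)
  qed
  then show ?case
    using chain_iso_chain[OF c(2)] has_height_iso[OF _ c(2)] chain_int_sum[of "pieces s", OF c(1)]
    by blast
qed

lemmas chain_chain_of = conjunct1[OF chain_of_chain_height]
lemmas has_height_chain_of = conjunct2[OF chain_of_chain_height]

lemma has_height_pieces:
  assumes "s \<in> S_fin (Suc (Suc n))" "Field (pieces s k) \<noteq> {}"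
  shows "has_height n (pieces s k)"
  using pieces_cases[OF assms] has_height_chain_of by metis

text \<open>
  Comparing different lists \<open>s\<close> and \<open>t\<close> is what makes the induction work: the pieces of two
  elements of the same chain may be \<open>\<A>(s\<^sup>+)\<close> and \<open>\<A>(s\<^sup>-)\<close>.
\<close>

lemma tail_chain_of:
  assumes "s \<in> S_fin (Suc n)" "t \<in> S_fin (Suc n)" "seq_minus s = seq_minus t"
    and "x \<in> Field (chain_of s)" "y \<in> Field (chain_of t)"
  shows "tail (chain_of s) x \<cong>\<^sub>c tail (chain_of t) y"
  using assms
proof (induction n arbitrary: s t x y)
  case 0
  then show ?case using chain_iso_refl by (auto simp: chain_of_S_fin_1 one_chain_def Field_def)
next
  case (Suc n)
  (* every piece is the chain of seq_minus s or of a list that differs from it in the last entry *)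
  have to_sum: "\<exists>k a. a \<in> Field (pieces s k) \<and> tail (chain_of s) x \<cong>\<^sub>c tail (int_sum (pieces s)) (k, a) \<and>
      (\<forall>i>k. pieces s i = chain_of (seq_minus s)) \<and>
      (\<exists>u \<in> S_fin (Suc n). pieces s k = chain_of u \<and> seq_minus u = seq_minus (seq_minus s))"
    if s: "s \<in> S_fin (Suc (Suc n))" and x: "x \<in> Field (chain_of s)" for s x
  proof -
    have c: "chain (pieces s k)" "chain_of s \<cong>\<^sub>c int_sum (pieces s)" for k
      by (rule chain_of_int_sum[OF s], erule chain_chain_of)+
    obtain f where f: "f ` Field (chain_of s) = Field (int_sum (pieces s))"
      "inj_on f (Field (chain_of s))"
      "\<forall>x\<in>Field (chain_of s). \<forall>y\<in>Field (chain_of s).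
        (x, y) \<in> chain_of s \<longleftrightarrow> (f x, f y) \<in> int_sum (pieces s)"
      by (rule chain_isoE[OF c(2)])
    obtain k a where ka: "f x = (k, a)" by (cases "f x")
    have "f x \<in> Field (int_sum (pieces s))" using f(1) x by blast
    then have a: "a \<in> Field (pieces s k)" using Field_int_sum[of "pieces s", OF c(1)] by (simp add: ka)
    have "tail (chain_of s) x \<cong>\<^sub>c tail (int_sum (pieces s)) (f x)"
      by (rule tail_iso[OF chain_chain_of[OF s] chain_int_sum[OF c(1)] f(1) x])
        (rule f(3)[rule_format])
    moreover have "\<forall>i>k. pieces s i = chain_of (seq_minus s)"
      using a by (auto simp: pieces_def split: if_splits)
    moreover have "\<exists>u \<in> S_fin (Suc n). pieces s k = chain_of u \<and> seq_minus u = seq_minus (seq_minus s)"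
      using pieces_cases[OF s, of k] a by blast
    ultimately show ?thesis using a by (auto simp: ka)
  qed
  obtain k a u where 1: "a \<in> Field (pieces s k)"
    "tail (chain_of s) x \<cong>\<^sub>c tail (int_sum (pieces s)) (k, a)"
    "\<forall>i>k. pieces s i = chain_of (seq_minus s)"
    "u \<in> S_fin (Suc n)" "pieces s k = chain_of u" "seq_minus u = seq_minus (seq_minus s)"
    using to_sum[OF Suc.prems(1,4)] by blast
  obtain l b v where 2: "b \<in> Field (pieces t l)"
    "tail (chain_of t) y \<cong>\<^sub>c tail (int_sum (pieces t)) (l, b)"
    "\<forall>i>l. pieces t i = chain_of (seq_minus t)"
    "v \<in> S_fin (Suc n)" "pieces t l = chain_of v" "seq_minus v = seq_minus (seq_minus t)"
    using to_sum[OF Suc.prems(2,5)] by blast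
  have "tail (pieces s k) a \<cong>\<^sub>c tail (pieces t l) b"
    unfolding 1(5) 2(5) using 1 2 Suc.prems(3) by (intro Suc.IH) simp_all
  then have "tail (int_sum (pieces s)) (k, a) \<cong>\<^sub>c tail (int_sum (pieces t)) (l, b)"
    using 1 2 Suc.prems chain_of_int_sum(1)[OF _ chain_chain_of]
    by (intro tail_int_sum_iso[where r = "chain_of (seq_minus s)"]) simp_all
  then show ?case by (rule chain_iso_trans[OF 1(2) chain_iso_trans[OF _ chain_iso_sym[OF 2(2)]]])
qed

lemma uniform_chain_of: "s \<in> S_fin (Suc n) \<Longrightarrow> uniform_chain (chain_of s)"
  using tail_chain_of[of s n s] chain_chain_of[of s n] by (simp add: uniform_chain_def)

section \<open>Increasing unions of convex subchains\<close>

text \<open>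
  Given chains \<open>S n\<close> such that \<open>S (n + 1)\<close> is the sum of pieces \<open>Q n k\<close>, \<open>k \<in> \<int>\<close>, with
  \<open>Q n 0 = S n\<close>, the union of the tower \<open>S 0 \<subseteq> S 1 \<subseteq> \<dots>\<close> is realised on the natural numbers.
  A natural number codes a triple: the level at which the element enters, the index of its piece
  at that level, and its place in the piece.
\<close>

definition lev :: "nat \<Rightarrow> nat" where
  "lev x = fst (prod_decode x)"

definition pos :: "nat \<Rightarrow> int" where
  "pos x = int_decode (fst (prod_decode (snd (prod_decode x))))"

definition val :: "nat \<Rightarrow> nat" where
  "val x = snd (prod_decode (snd (prod_decode x)))"

lemma lev_pos_val_surj: "\<exists>x. lev x = n \<and> pos x = k \<and> val x = a"
  by (rule exI[of _ "prod_encode (n, prod_encode (int_encode k, a))"])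
    (simp add: lev_def pos_def val_def)

lemma lev_pos_val_inj: "lev x = lev y \<Longrightarrow> pos x = pos y \<Longrightarrow> val x = val y \<Longrightarrow> x = y"
  unfolding lev_def pos_def val_def by (metis int_decode_eq prod.collapse prod_decode_eq)

text \<open>
  The pieces that enter at level \<open>m\<close>.  At level \<open>0\<close> there is only \<open>S 0\<close>; at level \<open>n + 1\<close> the piece
  of index \<open>0\<close> is missing, because it consists of the elements of the levels up to \<open>n\<close>.
\<close>

definition level_piece :: "(nat \<Rightarrow> nat rel) \<Rightarrow> (nat \<Rightarrow> int \<Rightarrow> nat rel) \<Rightarrow> nat \<Rightarrow> int \<Rightarrow> nat rel" where
  "level_piece S Q m k =
     (case m of 0 \<Rightarrow> if k = 0 then S 0 else {} | Suc n \<Rightarrow> if k = 0 then {} else Q n k)"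

text \<open>The elements that have entered up to level \<open>n\<close>.\<close>

definition stage :: "(nat \<Rightarrow> nat rel) \<Rightarrow> (nat \<Rightarrow> int \<Rightarrow> nat rel) \<Rightarrow> nat \<Rightarrow> nat set" where
  "stage S Q n = {x. val x \<in> Field (level_piece S Q (lev x) (pos x)) \<and> lev x \<le> n}"

text \<open>
  Of two elements of different levels, the sign of the index of the later one decides.  The
  membership conditions only say that the element occurs in the piece that it names.
\<close>

definition limit_chain :: "(nat \<Rightarrow> nat rel) \<Rightarrow> (nat \<Rightarrow> int \<Rightarrow> nat rel) \<Rightarrow> nat rel" where
  "limit_chain S Q = {(x, y). x \<in> stage S Q (lev x) \<and> y \<in> stage S Q (lev y) \<and>
     (lev x < lev y \<and> 0 < pos y \<or> lev y < lev x \<and> pos x < 0 \<or>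
      lev x = lev y \<and>
        (pos x < pos y \<or> pos x = pos y \<and> (val x, val y) \<in> level_piece S Q (lev x) (pos x)))}"

lemma stage_mono: "m \<le> n \<Longrightarrow> stage S Q m \<subseteq> stage S Q n"
  by (auto simp: stage_def)

lemma stage_lev: "x \<in> stage S Q n \<longleftrightarrow> x \<in> stage S Q (lev x) \<and> lev x \<le> n"
  by (auto simp: stage_def)

lemma pos_eq_0_iff: "x \<in> stage S Q n \<Longrightarrow> pos x = 0 \<longleftrightarrow> lev x = 0"
  by (auto simp: stage_def level_piece_def split: if_splits nat.splits)

lemma stage_convex:
  assumes "x \<in> stage S Q n" "z \<in> stage S Q n" "(x, y) \<in> limit_chain S Q" "(y, z) \<in> limit_chain S Q"
  shows "y \<in> stage S Q n"
  using assms by (subst stage_lev) (auto simp: limit_chain_def stage_lev[of _ _ _ n])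

context
  fixes S :: "nat \<Rightarrow> nat rel" and Q :: "nat \<Rightarrow> int \<Rightarrow> nat rel"
  assumes cS: "\<And>n. chain (S n)" and cQ: "\<And>n k. chain (Q n k)"
    and Q0: "\<And>n. Q n 0 = S n" and QS: "\<And>n. int_sum (Q n) \<cong>\<^sub>c S (Suc n)"
begin

text \<open>
  An isomorphism of the \<open>n\<close>-th stage with \<open>S n\<close> extends to one of the next stage with the sum of
  the pieces, where the \<open>n\<close>-th stage becomes the piece of index \<open>0\<close>.
\<close>

lemma stage_step:
  assumes g: "g ` stage S Q n = Field (S n)"
    "\<forall>x\<in>stage S Q n. \<forall>y\<in>stage S Q n. (x, y) \<in> limit_chain S Q \<longleftrightarrow> (g x, g y) \<in> S n"
  shows "\<exists>j. j ` stage S Q (Suc n) = Field (int_sum (Q n)) \<and>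
    (\<forall>x\<in>stage S Q (Suc n). \<forall>y\<in>stage S Q (Suc n).
       (x, y) \<in> limit_chain S Q \<longleftrightarrow> (j x, j y) \<in> int_sum (Q n)) \<and>
    (\<forall>x\<in>stage S Q (Suc n). fst (j x) = 0 \<longleftrightarrow> x \<in> stage S Q n)"
proof (intro exI conjI ballI)
  let ?j = "\<lambda>x. if lev x \<le> n then (0, g x) else (pos x, val x)"
  note F = Field_int_sum[of "Q n", OF cQ]
  have old: "x \<in> stage S Q n \<longleftrightarrow> lev x \<le> n" if "x \<in> stage S Q (Suc n)" for x
    using that by (simp add: stage_def)
  have new: "lev x = Suc n" "pos x \<noteq> 0" "val x \<in> Field (Q n (pos x))"
    if "x \<in> stage S Q (Suc n)" "\<not> lev x \<le> n" for x
  proof -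
    show l: "lev x = Suc n" using that by (simp add: stage_def)
    show "pos x \<noteq> 0" using pos_eq_0_iff[OF that(1)] l by simp
    then show "val x \<in> Field (Q n (pos x))" using that(1) l by (simp add: stage_def level_piece_def)
  qed
  have gF: "g x \<in> Field (Q n 0)" if "x \<in> stage S Q n" for x using that g(1) Q0 by auto
  show "?j ` stage S Q (Suc n) = Field (int_sum (Q n))"
  proof
    show "?j ` stage S Q (Suc n) \<subseteq> Field (int_sum (Q n))"
    proof
      fix p assume "p \<in> ?j ` stage S Q (Suc n)"
      then obtain x where x: "x \<in> stage S Q (Suc n)" "p = ?j x" by blast
      show "p \<in> Field (int_sum (Q n))"
        using new(3)[OF x(1)] gF[of x] old[OF x(1)] by (simp add: x(2) F)
    qed
    show "Field (int_sum (Q n)) \<subseteq> ?j ` stage S Q (Suc n)"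
    proof
      fix p assume p: "p \<in> Field (int_sum (Q n))"
      obtain k a where ka: "p = (k, a)" by (cases p)
      have a: "a \<in> Field (Q n k)" using p by (simp add: ka F)
      show "p \<in> ?j ` stage S Q (Suc n)"
      proof (cases "k = 0")
        case True
        then have "a \<in> g ` stage S Q n" unfolding g(1) using a Q0 by simp
        then obtain x where "x \<in> stage S Q n" "a = g x" by blast
        then show ?thesis using True stage_mono[of n "Suc n" S Q]
          by (intro image_eqI[of _ _ x]) (auto simp: ka stage_def)
      next
        case False
        obtain x where "lev x = Suc n" "pos x = k" "val x = a" using lev_pos_val_surj by blast
        then show ?thesis using False a
          by (intro image_eqI[of _ _ x]) (auto simp: ka stage_def level_piece_def)
      qed
    qed
  qed
  fix x assume x: "x \<in> stage S Q (Suc n)"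
  show "fst (?j x) = 0 \<longleftrightarrow> x \<in> stage S Q n" using old[OF x] new(2)[OF x] by simp
  fix y assume y: "y \<in> stage S Q (Suc n)"
  have xy: "x \<in> stage S Q (lev x)" "y \<in> stage S Q (lev y)" using x y stage_lev by blast+
  consider "lev x \<le> n" "lev y \<le> n" | "lev x \<le> n" "\<not> lev y \<le> n" | "\<not> lev x \<le> n" "lev y \<le> n"
    | "\<not> lev x \<le> n" "\<not> lev y \<le> n" by blast
  then show "(x, y) \<in> limit_chain S Q \<longleftrightarrow> (?j x, ?j y) \<in> int_sum (Q n)"
  proof cases
    case 1
    then have "x \<in> stage S Q n" "y \<in> stage S Q n" using old x y by blast+
    then show ?thesis using 1 g(2) gF by (simp add: int_sum_iff) (simp add: Q0)
  next
    case 2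
    have "x \<in> stage S Q n" using 2 old x by blast
    then show ?thesis using 2 new[OF y 2(2)] gF xy by (auto simp: int_sum_iff limit_chain_def)
  next
    case 3
    have "y \<in> stage S Q n" using 3 old y by blast
    then show ?thesis using 3 new[OF x 3(1)] gF xy by (auto simp: int_sum_iff limit_chain_def)
  next
    case 4
    then show ?thesis using new[OF x 4(1)] new[OF y 4(2)] xy
      by (auto simp: int_sum_iff limit_chain_def level_piece_def)
  qed
qed

lemma stage_iso:
  "\<exists>g. g ` stage S Q n = Field (S n) \<and>
    (\<forall>x\<in>stage S Q n. \<forall>y\<in>stage S Q n. (x, y) \<in> limit_chain S Q \<longleftrightarrow> (g x, g y) \<in> S n)"
proof (induction n)
  case 0
  have st: "x \<in> stage S Q 0 \<longleftrightarrow> lev x = 0 \<and> pos x = 0 \<and> val x \<in> Field (S 0)" for x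
    by (auto simp: stage_def level_piece_def split: if_splits nat.splits)
  have "val ` stage S Q 0 = Field (S 0)"
  proof
    show "val ` stage S Q 0 \<subseteq> Field (S 0)" by (auto simp: st)
    show "Field (S 0) \<subseteq> val ` stage S Q 0"
    proof
      fix a assume "a \<in> Field (S 0)"
      moreover obtain x where "lev x = 0" "pos x = 0" "val x = a" using lev_pos_val_surj by blast
      ultimately show "a \<in> val ` stage S Q 0" by (intro image_eqI[of _ _ x]) (simp_all add: st)
    qed
  qed
  moreover have "(x, y) \<in> limit_chain S Q \<longleftrightarrow> (val x, val y) \<in> S 0"
    if "x \<in> stage S Q 0" "y \<in> stage S Q 0" for x y
    using that by (simp add: st limit_chain_def level_piece_def)
  ultimately show ?case by (intro exI[of _ val]) simp
next
  case (Suc n)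
  then obtain g where g: "g ` stage S Q n = Field (S n)"
    "\<forall>x\<in>stage S Q n. \<forall>y\<in>stage S Q n. (x, y) \<in> limit_chain S Q \<longleftrightarrow> (g x, g y) \<in> S n" by blast
  obtain j where j: "j ` stage S Q (Suc n) = Field (int_sum (Q n))"
    "\<forall>x\<in>stage S Q (Suc n). \<forall>y\<in>stage S Q (Suc n).
       (x, y) \<in> limit_chain S Q \<longleftrightarrow> (j x, j y) \<in> int_sum (Q n)"
    using stage_step[OF g] by blast
  obtain f where f: "f ` Field (int_sum (Q n)) = Field (S (Suc n))" "inj_on f (Field (int_sum (Q n)))"
    "\<forall>x\<in>Field (int_sum (Q n)). \<forall>y\<in>Field (int_sum (Q n)).
       (x, y) \<in> int_sum (Q n) \<longleftrightarrow> (f x, f y) \<in> S (Suc n)"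
    by (rule chain_isoE[OF QS])
  have jF: "j x \<in> Field (int_sum (Q n))" if "x \<in> stage S Q (Suc n)" for x using j(1) that by blast
  have "(f \<circ> j) ` stage S Q (Suc n) = Field (S (Suc n))" 
    unfolding image_comp[symmetric] j(1) f(1) ..
  moreover have "(x, y) \<in> limit_chain S Q \<longleftrightarrow> ((f \<circ> j) x, (f \<circ> j) y) \<in> S (Suc n)"
    if "x \<in> stage S Q (Suc n)" "y \<in> stage S Q (Suc n)" for x y
    using j(2) f(3) that jF by simp
  ultimately show ?case by (intro exI[of _ "f \<circ> j"]) simp
qed

lemma chain_level_piece: "chain (level_piece S Q m k)"
  using cS cQ chainI[of "{}"] by (simp add: level_piece_def split: nat.split)

lemma Field_limit_chain: "x \<in> Field (limit_chain S Q) \<longleftrightarrow> x \<in> stage S Q (lev x)"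
proof
  show "x \<in> Field (limit_chain S Q) \<Longrightarrow> x \<in> stage S Q (lev x)"
    by (auto simp: Field_def limit_chain_def)
  assume "x \<in> stage S Q (lev x)"
  then have "(x, x) \<in> limit_chain S Q"
    using chain_refl[OF chain_level_piece] by (simp add: limit_chain_def stage_def)
  then show "x \<in> Field (limit_chain S Q)" by (rule FieldD)
qed

lemma Field_limit_chain_UN: "Field (limit_chain S Q) = (\<Union>n. stage S Q n)"
  using Field_limit_chain stage_lev by blast

lemma chain_limit_chain: "chain (limit_chain S Q)"
proof (rule chainI)
  fix x y z
  note F = Field_limit_chain
  note c = chain_level_piece[of "lev x" "pos x"]
  show "x \<in> Field (limit_chain S Q) \<Longrightarrow> (x, x) \<in> limit_chain S Q"
    using chain_refl[OF c, of "val x"] unfolding F by (simp add: limit_chain_def stage_def)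
  show "x = y" if "(x, y) \<in> limit_chain S Q" "(y, x) \<in> limit_chain S Q"
  proof -
    have l: "lev x = lev y" using that unfolding limit_chain_def by auto
    have p: "pos x = pos y" using that l unfolding limit_chain_def by auto
    have "(val x, val y) \<in> level_piece S Q (lev x) (pos x)"
      "(val y, val x) \<in> level_piece S Q (lev x) (pos x)"
      using that unfolding limit_chain_def mem_Collect_eq prod.case l p by auto
    then have "val x = val y" by (rule chain_antisym[OF c])
    with l p show ?thesis by (rule lev_pos_val_inj)
  qed
  show "(x, y) \<in> limit_chain S Q \<or> (y, x) \<in> limit_chain S Q"
    if "x \<in> Field (limit_chain S Q)" "y \<in> Field (limit_chain S Q)"
  proof (cases "lev x = lev y \<and> pos x = pos y")
    case True
    then have "(val x, val y) \<in> level_piece S Q (lev x) (pos x) \<or>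
        (val y, val x) \<in> level_piece S Q (lev x) (pos x)"
      using that unfolding F by (intro chain_total[OF c]) (simp_all add: stage_def)
    then show ?thesis using True that unfolding F by (auto simp: limit_chain_def)
  next
    case False
    have st: "x \<in> stage S Q (lev x)" "y \<in> stage S Q (lev y)" using that F by blast+
    have "lev x < lev y \<Longrightarrow> pos y \<noteq> 0" "lev y < lev x \<Longrightarrow> pos x \<noteq> 0"
      using pos_eq_0_iff[OF st(1)] pos_eq_0_iff[OF st(2)] by auto
    then consider "lev x < lev y" "0 < pos y" | "lev x < lev y" "pos y < 0"
      | "lev y < lev x" "0 < pos x" | "lev y < lev x" "pos x < 0"
      | "lev x = lev y" "pos x < pos y" | "lev x = lev y" "pos y < pos x"
      using False by linarith
    then show ?thesis using st by cases (simp_all add: limit_chain_def)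
  qed
  show "(x, z) \<in> limit_chain S Q" if xyz: "(x, y) \<in> limit_chain S Q" "(y, z) \<in> limit_chain S Q"
  proof -
    define n where "n = max (lev x) (max (lev y) (lev z))"
    have st: "x \<in> stage S Q n" "y \<in> stage S Q n" "z \<in> stage S Q n"
      using xyz stage_lev[of _ S Q n] by (auto simp: limit_chain_def n_def)
    obtain g where "\<forall>x\<in>stage S Q n. \<forall>y\<in>stage S Q n. (x, y) \<in> limit_chain S Q \<longleftrightarrow> (g x, g y) \<in> S n"
      using stage_iso by blast
    then show ?thesis using xyz st chain_trans[OF cS, of "g x" "g y" n "g z"] by blast
  qed
qed

abbreviation Lim :: "nat rel" where "Lim \<equiv> limit_chain S Q"
abbreviation St :: "nat \<Rightarrow> nat set" where "St \<equiv> stage S Q"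

lemma stage_subset: "St n \<subseteq> Field Lim"
  unfolding Field_limit_chain_UN by blast

lemma Field_Restr_stage: "Field (Restr Lim (St n)) = St n"
  using Field_Restr_chain[OF chain_limit_chain] stage_subset by blast

lemma Restr_stage_iso: "Restr Lim (St n) \<cong>\<^sub>c S n"
proof -
  obtain g where g: "g ` St n = Field (S n)"
    "\<forall>x\<in>St n. \<forall>y\<in>St n. (x, y) \<in> Lim \<longleftrightarrow> (g x, g y) \<in> S n"
    using stage_iso by blast
  show ?thesis
  proof (rule chain_isoI[where f = g])
    show "chain (Restr Lim (St n))" by (rule chain_Restr[OF chain_limit_chain])
    show "g ` Field (Restr Lim (St n)) = Field (S n)" unfolding Field_Restr_stage by (rule g(1))
    show "(x, y) \<in> Restr Lim (St n) \<longleftrightarrow> (g x, g y) \<in> S n"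
      if "x \<in> Field (Restr Lim (St n))" "y \<in> Field (Restr Lim (St n))" for x y
      using that g(2) unfolding Field_Restr_stage by simp
  qed
qed

lemma stage_embedding: "convex_embedding id (Restr Lim (St n)) Lim"
  unfolding convex_embedding_def Field_Restr_stage
proof (intro conjI ballI allI impI)
  fix x y z assume "x \<in> St n" "z \<in> St n" "(id x, y) \<in> Lim" "(y, id z) \<in> Lim"
  then show "y \<in> id ` St n" using stage_convex[of x S Q n z y] by simp
qed (use stage_subset in auto)

lemma uniform_limit_chain:
  assumes "\<And>n. uniform_chain (S n)"
  shows "uniform_chain Lim"
  unfolding uniform_chain_def
proof (intro conjI ballI)
  show "chain Lim" by (rule chain_limit_chain)
  fix x y assume "x \<in> Field Lim" "y \<in> Field Lim"
  then have "x \<in> St (max (lev x) (lev y))" "y \<in> St (max (lev x) (lev y))"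
    using Field_limit_chain stage_mono[of "lev x" "max (lev x) (lev y)" S Q]
      stage_mono[of "lev y" "max (lev x) (lev y)" S Q] by auto
  then obtain n where st: "x \<in> St n" "y \<in> St n" by blast
  obtain g where g: "g ` St n = Field (S n)"
    "\<forall>x\<in>St n. \<forall>y\<in>St n. (x, y) \<in> Lim \<longleftrightarrow> (g x, g y) \<in> S n"
    using stage_iso by blast
  have tl: "tail (Restr Lim (St n)) z \<cong>\<^sub>c tail (S n) (g z)" if "z \<in> St n" for z
    by (rule tail_iso[OF chain_Restr[OF chain_limit_chain] cS])
      (use g that in \<open>simp_all add: Field_Restr_stage\<close>)
  have "tail (S n) (g x) \<cong>\<^sub>c tail (S n) (g y)"
    using assms[of n] g(1) st unfolding uniform_chain_def by blast
  then have xy: "tail (Restr Lim (St n)) x \<cong>\<^sub>c tail (Restr Lim (St n)) y"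
    by (rule chain_iso_trans[OF tl[OF st(1)] chain_iso_trans[OF _ chain_iso_sym[OF tl[OF st(2)]]]])
  (* what lies beyond the stage n does not depend on the element of the stage *)
  define U where "U = {z \<in> Field Lim - St n. (x, z) \<in> Lim}"
  have U: "U = {z \<in> Field Lim - St n. (w, z) \<in> Lim}" if "w \<in> St n" for w
  proof -
    have "(w', z) \<in> Lim" if "z \<in> Field Lim" "z \<notin> St n" "(w, z) \<in> Lim" "w \<in> St n" "w' \<in> St n" for w w' z
    proof (rule ccontr)
      assume "(w', z) \<notin> Lim"
      then have "(z, w') \<in> Lim"
        using chain_total[OF chain_limit_chain, of w' z] that stage_subset by blast
      then show False using stage_convex that by blast
    qed
    then show ?thesis using st that unfolding U_def by blast
  qed
  have split: "above Lim w = (above Lim w \<inter> St n) \<union> U" if "w \<in> St n" for w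
    unfolding U[OF that] by (auto simp: above_def Field_def)
  have tr: "tail (Restr Lim (St n)) w = Restr Lim (above Lim w \<inter> St n)" if "w \<in> St n" for w
    using that by (auto simp: above_def)
  have "Restr Lim (above Lim x \<inter> St n \<union> U) \<cong>\<^sub>c Restr Lim (above Lim y \<inter> St n \<union> U)"
  proof (rule chain_iso_glue)
    show "chain Lim" "chain Lim" by (rule chain_limit_chain)+
    show "Restr Lim (above Lim x \<inter> St n) \<cong>\<^sub>c Restr Lim (above Lim y \<inter> St n)"
      using xy unfolding tr[OF st(1)] tr[OF st(2)] .
    show "Restr Lim U \<cong>\<^sub>c Restr Lim U" by (rule chain_iso_refl)
    show "above Lim x \<inter> St n \<union> U \<subseteq> Field Lim" "above Lim y \<inter> St n \<union> U \<subseteq> Field Lim"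
      using stage_subset by (auto simp: U_def)
    have *: "(b, u) \<in> Lim \<and> (u, b) \<notin> Lim" if "b \<in> St n" "u \<in> U" for b u
    proof -
      have "(b, u) \<in> Lim" "u \<notin> St n" using that U[OF that(1)] by blast+
      then show ?thesis using stage_convex[OF that(1,1)] by blast
    qed
    show "(b, u) \<in> Lim \<and> (u, b) \<notin> Lim" if "b \<in> above Lim x \<inter> St n" "u \<in> U" for b u
      using * that by blast
    show "(b, u) \<in> Lim \<and> (u, b) \<notin> Lim" if "b \<in> above Lim y \<inter> St n" "u \<in> U" for b u
      using * that by blast
  qed
  then show "tail Lim x \<cong>\<^sub>c tail Lim y"
    unfolding split[OF st(1), symmetric] split[OF st(2), symmetric] .
qed

context
  assumes hS: "\<And>n. has_height n (S n)"
    and hQ: "\<And>n k. Field (Q n k) \<noteq> {} \<Longrightarrow> has_height n (Q n k)"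
begin

lemma rho_limit_stage:
  assumes "x \<in> St m" "y \<in> St m"
  shows "(x, y) \<in> rho (Restr Lim (St m)) (enat n) \<longleftrightarrow> (x, y) \<in> rho Lim (enat n)"
  using rho_convex_embedding[OF chain_Restr[OF chain_limit_chain] chain_limit_chain stage_embedding,
      of x m y n] assms unfolding Field_Restr_stage by simp

lemma has_height_stage: "has_height n (Restr Lim (St n))"
  by (rule has_height_iso[OF cS Restr_stage_iso hS])

text \<open>
  An element of level \<open>m + 1\<close> with \<open>m \<ge> n\<close> lies, within the stage \<open>m + 1\<close>, in another piece than
  \<open>x\<close>, and pieces are the \<open>\<rho>\<^sub>m\<close>-classes there.
\<close>

lemma rho_limit_chain:
  assumes x: "x \<in> St n"
  shows "rho Lim (enat n) `` {x} = St n"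
proof
  show "St n \<subseteq> rho Lim (enat n) `` {x}"
    using rho_limit_stage[OF x] has_height_stage x
    unfolding has_height_def Field_Restr_stage by blast
  show "rho Lim (enat n) `` {x} \<subseteq> St n"
  proof
    fix y assume "y \<in> rho Lim (enat n) `` {x}"
    then have xy: "(x, y) \<in> rho Lim (enat n)" by blast
    have y: "y \<in> St (lev y)"
      using rho_Field[OF chain_limit_chain xy] Field_limit_chain by blast
    show "y \<in> St n"
    proof (cases "lev y \<le> n")
      case True
      then show ?thesis using y stage_lev by blast
    next
      case False
      then obtain m where m: "lev y = Suc m" "n \<le> m" by (cases "lev y") auto
      obtain g where g: "g ` St m = Field (S m)"
        "\<forall>x\<in>St m. \<forall>y\<in>St m. (x, y) \<in> Lim \<longleftrightarrow> (g x, g y) \<in> S m"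
        using stage_iso by blast
      obtain j where j: "j ` St (Suc m) = Field (int_sum (Q m))"
        "\<forall>x\<in>St (Suc m). \<forall>y\<in>St (Suc m). (x, y) \<in> Lim \<longleftrightarrow> (j x, j y) \<in> int_sum (Q m)"
        "\<forall>x\<in>St (Suc m). fst (j x) = 0 \<longleftrightarrow> x \<in> St m"
        using stage_step[OF g] by blast
      have cI: "chain (int_sum (Q m))" by (rule chain_int_sum[of "Q m", OF cQ])
      have emb: "convex_embedding j (Restr Lim (St (Suc m))) (int_sum (Q m))"
        by (rule onto_convex_embedding) (use j(1,2) in \<open>simp_all add: Field_Restr_stage\<close>)
      have xm: "x \<in> St m" "x \<in> St (Suc m)" 
        using x stage_mono[OF m(2)] stage_mono[of n "Suc m" S Q] m(2) by auto
      have ym: "y \<in> St (Suc m)" using y m(1) by simp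
      have "(x, y) \<in> rho Lim (enat m)" by (rule rho_mono[OF chain_limit_chain m(2) xy])
      then have "(x, y) \<in> rho (Restr Lim (St (Suc m))) (enat m)"
        using rho_limit_stage[OF xm(2) ym] by blast
      then have r: "(j x, j y) \<in> rho (int_sum (Q m)) (enat m)"
        using rho_convex_embedding[OF chain_Restr[OF chain_limit_chain] cI emb, of x y m] xm ym
        unfolding Field_Restr_stage by blast
      obtain k a l b where e: "j x = (k, a)" "j y = (l, b)" by (cases "j x", cases "j y")
      have "(k, a) \<in> Field (int_sum (Q m))" "(l, b) \<in> Field (int_sum (Q m))"
        unfolding e[symmetric] using j(1) xm ym by blast+
      then have "a \<in> Field (Q m k)" "b \<in> Field (Q m l)" using Field_int_sum[of "Q m", OF cQ] by blast+
      then have "k = l" using rho_int_sum[of "Q m", OF cQ hQ] r unfolding e by blast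
      moreover have "k = 0" using j(3) xm e(1) by force
      ultimately have "fst (j y) = 0" using e(2) by simp
      then have "y \<in> St m" using j(3) ym by blast
      then have "lev y \<le> m" by (simp add: stage_def)
      then show ?thesis using m(1) by simp
    qed
  qed
qed

lemma component_limit_chain:
  assumes "x \<in> St n"
  shows "component Lim (enat n) x \<cong>\<^sub>c S n"
  unfolding component_def rho_limit_chain[OF assms] by (rule Restr_stage_iso)

lemma rho_limit_chain_infinity: "rho Lim (\<infinity>::enat) = Field Lim \<times> Field Lim"
proof (intro equalityI subrelI)
  fix x y
  show "(x, y) \<in> rho Lim (\<infinity>::enat) \<Longrightarrow> (x, y) \<in> Field Lim \<times> Field Lim"
    using rho_Field[OF chain_limit_chain] by (auto simp: rho_enat_infinity)
  assume "(x, y) \<in> Field Lim \<times> Field Lim"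
  then have xy: "x \<in> St (max (lev x) (lev y))" "y \<in> St (max (lev x) (lev y))"
    using Field_limit_chain stage_mono[of "lev x" "max (lev x) (lev y)" S Q]
      stage_mono[of "lev y" "max (lev x) (lev y)" S Q] by auto
  then show "(x, y) \<in> rho Lim (\<infinity>::enat)" using rho_limit_chain[OF xy(1)] by (auto simp: rho_enat_infinity)
qed

lemma rho_limit_chain_not_total: "rho Lim (enat n) \<noteq> Field Lim \<times> Field Lim"
proof -
  obtain x y where xy: "(x, y) \<in> Restr Lim (St (Suc n))"
    "(x, y) \<notin> rho (Restr Lim (St (Suc n))) (enat n)"
    using has_height_stage[of "Suc n"] unfolding has_height_def by blast
  then have "(x, y) \<notin> rho Lim (enat n)" using rho_limit_stage[of x "Suc n" y n] by blast
  then show ?thesis using xy(1) by (auto simp: Field_def)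
qed

end

end

lemma quotient_chain_one_iff:
  assumes r: "chain r" and ne: "Field r \<noteq> {}" and e: "equiv (Field r) e"
  shows "quotient_chain r e \<cong>\<^sub>c one_chain \<longleftrightarrow> e = Field r \<times> Field r"
proof
  have one: "Field one_chain = {0}" by (simp add: one_chain_def Field_def)
  have q: "e `` {x} \<in> Field (quotient_chain r e)" if "x \<in> Field r" for x
  proof (rule FieldD)
    show "(e `` {x}, e `` {x}) \<in> quotient_chain r e"
      using that chain_refl[OF r that] equiv_class_self[OF e that]
      by (auto simp: quotient_chain_def quotientI)
  qed
  show "e = Field r \<times> Field r" if iso: "quotient_chain r e \<cong>\<^sub>c one_chain"
  proof -
    obtain f :: "'a set \<Rightarrow> nat" where f: "bij_betw f (Field (quotient_chain r e)) {0}"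
      using iso unfolding chain_iso_def one by blast
    have "(x, y) \<in> e" if "x \<in> Field r" "y \<in> Field r" for x y
    proof -
      have "f (e `` {x}) = f (e `` {y})" using bij_betw_apply[OF f] q that by simp
      then have "e `` {x} = e `` {y}" using f q that by (auto simp: bij_betw_def dest: inj_onD)
      then show ?thesis using eq_equiv_class_iff[OF e that] by blast
    qed
    then show ?thesis using e by (auto simp: equiv_def)
  qed
  assume "e = Field r \<times> Field r"
  then have "Field r // e = {Field r}" using ne by (auto simp: quotient_def)
  then have "quotient_chain r e = {(Field r, Field r)}"
    using ne chain_refl[OF r] by (auto simp: quotient_chain_def)
  then show "quotient_chain r e \<cong>\<^sub>c one_chain"
    unfolding chain_iso_def by (intro exI[of _ "\<lambda>_. 0"]) (auto simp: one_chain_def Field_def bij_betw_def)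
qed

section \<open>Realising a derived sequence\<close>

lemma next_nonzero_self: "\<pi> n > 0 \<Longrightarrow> next_nonzero \<pi> n = enat n"
  unfolding next_nonzero_def by (auto intro!: Least_equality)

lemma next_nonzero_Suc: "\<pi> n = 0 \<Longrightarrow> next_nonzero \<pi> n = next_nonzero \<pi> (Suc n)"
proof -
  assume 0: "\<pi> n = 0"
  have "n \<le> v \<and> \<pi> v > 0 \<longleftrightarrow> Suc n \<le> v \<and> \<pi> v > 0" for v
    using 0 by (auto simp: Suc_le_eq order_le_less)
  then show ?thesis unfolding next_nonzero_def by simp
qed

text \<open>Both cases of the definition agree in form, since \<open>w\<^sub>n = n\<close> if \<open>\<pi>(n) > 0\<close>.\<close>

lemma derived_eq:
  "derived \<sigma> \<pi> n = map (\<lambda>i. \<sigma> (enat i)) [0..<n] @ [\<sigma> (next_nonzero \<pi> n)]"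
  by (simp add: derived_def next_nonzero_self)

text \<open>
  The chain \<open>\<A>(s\<^sub>n)\<close> is the least piece of \<open>\<A>(s\<^sub>n\<^sub>+\<^sub>1)\<close> if \<open>\<pi>(n) = 0\<close>; otherwise the piece of
  index \<open>1\<close> serves, as would any other except a least one.
\<close>

lemma pieces_derived:
  assumes c: "compatible \<sigma> \<pi>"
  shows "pieces (derived \<sigma> \<pi> (Suc n)) (if \<pi> n = 0 then 0 else 1) = chain_of (derived \<sigma> \<pi> n)"
proof (cases "\<pi> n = 0")
  case True
  then have "\<sigma> (next_nonzero \<pi> (Suc n)) \<le> enat n"
    using c next_nonzero_Suc[of \<pi> n] by (auto simp: compatible_def)
  then have "last (derived \<sigma> \<pi> (Suc n)) \<noteq> enat (length (derived \<sigma> \<pi> (Suc n)) - 1)"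
    by (auto simp: derived_eq)
  moreover have "seq_plus (derived \<sigma> \<pi> (Suc n)) = derived \<sigma> \<pi> n"
    using True by (simp add: derived_eq seq_plus_def butlast_append next_nonzero_Suc[of \<pi> n])
  ultimately show ?thesis using True by (simp add: pieces_def)
next
  case False
  then have "seq_minus (derived \<sigma> \<pi> (Suc n)) = derived \<sigma> \<pi> n"
    by (simp add: derived_eq seq_minus_def butlast_append next_nonzero_self)
  then show ?thesis using False by (simp add: pieces_def)
qed

lemma int_sum_shift:
  assumes P: "\<And>k. chain (P k)"
  shows "int_sum (\<lambda>k. P (k + c)) \<cong>\<^sub>c int_sum P"
proof (rule chain_isoI[where f = "\<lambda>(k, a). (k + c, a)"])
  let ?f = "\<lambda>(k, a). (k + c, a)"
  note F = Field_int_sum[of P, OF P] and F' = Field_int_sum[of "\<lambda>k. P (k + c)", OF P]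
  show "chain (int_sum (\<lambda>k. P (k + c)))" by (rule chain_int_sum[OF P])
  show "?f ` Field (int_sum (\<lambda>k. P (k + c))) = Field (int_sum P)"
  proof
    show "?f ` Field (int_sum (\<lambda>k. P (k + c))) \<subseteq> Field (int_sum P)" by (auto simp: F F')
    show "Field (int_sum P) \<subseteq> ?f ` Field (int_sum (\<lambda>k. P (k + c)))"
    proof
      fix x assume "x \<in> Field (int_sum P)"
      then show "x \<in> ?f ` Field (int_sum (\<lambda>k. P (k + c)))"
        by (intro image_eqI[of _ _ "(fst x - c, snd x)"]) (cases x; simp add: F F')+
    qed
  qed
  show "(x, y) \<in> int_sum (\<lambda>k. P (k + c)) \<longleftrightarrow> (?f x, ?f y) \<in> int_sum P" for x y
    by (cases x, cases y) (simp add: int_sum_iff)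
qed

theorem mainTheorem7:
  fixes \<sigma> :: "enat \<Rightarrow> enat" and \<pi> :: "nat \<Rightarrow> enat"
  assumes "\<sigma> \<in> S_omega_plus_one" and "compatible \<sigma> \<pi>"
  shows "\<exists>(A :: nat rel) x. uniform_chain A \<and> has_rank A (\<infinity>::enat) \<and> x \<in> Field A \<and>
           (\<forall>n::nat. component A (enat n) x \<cong>\<^sub>c chain_of (derived \<sigma> \<pi> n))"
proof -
  let ?s = "derived \<sigma> \<pi>"
  have s: "?s n \<in> S_fin (Suc n)" for n using derived_in_S_fin[OF assms, of n] by simp
  define S where "S n = chain_of (?s n)" for n
  (* the pieces are renumbered so that index 0 is the place of the previous chain *)
  define Q where "Q n k = pieces (?s (Suc n)) (k + (if \<pi> n = 0 then 0 else 1))" for n k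
  have cP: "chain (pieces (?s (Suc n)) k)" for n k
    by (rule chain_of_int_sum(1)[OF s]) (rule chain_chain_of)
  have cS: "chain (S n)" for n unfolding S_def by (rule chain_chain_of[OF s])
  have cQ: "chain (Q n k)" for n k unfolding Q_def by (rule cP)
  have Q0: "Q n 0 = S n" for n using pieces_derived[OF assms(2)] by (simp add: Q_def S_def)
  have QS: "int_sum (Q n) \<cong>\<^sub>c S (Suc n)" for n
  proof -
    have "chain_of (?s (Suc n)) \<cong>\<^sub>c int_sum (pieces (?s (Suc n)))"
      by (rule chain_of_int_sum(2)[OF s]) (rule chain_chain_of)
    then show ?thesis
      unfolding Q_def S_def
      by (rule chain_iso_trans[OF int_sum_shift[of "pieces (?s (Suc n))", OF cP] chain_iso_sym])
  qed
  have hS: "has_height n (S n)" for n unfolding S_def by (rule has_height_chain_of[OF s])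
  have hQ: "has_height n (Q n k)" if "Field (Q n k) \<noteq> {}" for n k
    using that unfolding Q_def by (rule has_height_pieces[OF s])
  have uS: "uniform_chain (S n)" for n unfolding S_def by (rule uniform_chain_of[OF s])
  note lim = cS cQ Q0 QS
  let ?A = "limit_chain S Q"
  have cA: "chain ?A" by (rule chain_limit_chain[of S Q, OF lim])
  obtain g where "g ` stage S Q 0 = Field (S 0)"
    using stage_iso[of S Q 0, OF lim] by blast
  moreover have "Field (S 0) \<noteq> {}" using hS[of 0] by (simp add: has_height_def)
  ultimately obtain x where x: "x \<in> stage S Q 0" by blast
  have xn: "x \<in> stage S Q n" for n using x stage_mono[of 0 n S Q] by blast
  have xF: "x \<in> Field ?A" using x stage_subset[of S Q 0, OF lim] by blast
  have comp: "component ?A (enat n) x \<cong>\<^sub>c chain_of (?s n)" for n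
    using component_limit_chain[of S Q, OF lim hS hQ xn] by (simp add: S_def)
  have inf: "rho ?A (\<infinity>::enat) = Field ?A \<times> Field ?A"
    by (rule rho_limit_chain_infinity[of S Q, OF lim hS hQ])
  have rank: "has_rank ?A (\<infinity>::enat)"
    unfolding has_rank_def
  proof (intro conjI allI impI)
    have "equiv (Field ?A) (Field ?A \<times> Field ?A)"
      by (auto simp: equiv_def refl_on_def sym_def trans_def)
    then show "quotient_chain ?A (rho ?A (\<infinity>::enat)) \<cong>\<^sub>c one_chain"
      unfolding inf using quotient_chain_one_iff[OF cA] xF by blast
    fix \<beta> :: enat assume "\<beta> < \<infinity>"
    then obtain n where n: "\<beta> = enat n" by (cases \<beta>) auto
    have "equiv (Field ?A) (rho ?A \<beta>)"
      using convex_equiv_rho[OF cA, of n] by (simp add: n convex_equiv_def)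
    then show "\<not> quotient_chain ?A (rho ?A \<beta>) \<cong>\<^sub>c one_chain"
      using quotient_chain_one_iff[OF cA] xF rho_limit_chain_not_total[of S Q, OF lim hS hQ]
      unfolding n by blast
  qed
  show ?thesis
    using uniform_limit_chain[of S Q, OF lim uS] rank xF comp by blast
qed

end
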